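(* Assume that the $\xi_n$ are i.i.d. If $\mathbb{E}m_0(t)\in(0,\infty)$ for all $t\in\mathbb{R}$, then the sequence of finite measures $A\mapsto\mathbb{E}Z_n(nA)$ satisfies a large deviation principle with rate function $\Lambda_a^*$: for each measurable (Borel) subset $A$ of $\mathbb{R}$, $$-\inf_{x\in A^o}\Lambda_a^*(x)\le\liminf_{n\to\infty}\frac1n\log\mathbb{E}Z_n(nA)\le\limsup_{n\to\infty}\frac1n\log\mathbb{E}Z_n(nA)\le-\inf_{x\in\bar A}\Lambda_a^*(x),$$ where $A^o$ denotes the interior of $A$ and $\bar A$ its closure.
   Context: Branching random walk in a random environment in time. Let $\xi=(\xi_n)_{n\ge 0}$ be a stationary and ergodic sequence of random variables with values in a measurable space $\Theta$; each realization of $\xi_n$ determines a probability distribution $\eta_n=\eta(\xi_n)$ on $\mathbb{N}\times\mathbb{R}\times\mathbb{R}\times\cdots$. Given $\xi$ (quenched law $\mathbb{P}_\xi$, expectation $\mathbb{E}_\xi$), let $X(u)=(N(u),L_1(u),L_2(u),\dots)$, indexed by finite sequences $u\in\{\emptyset\}\cup\bigcup_{n\ge1}\mathbb{N}^n$, be independent random vectors, $X(u)$ having law $\eta_n$ when the length $|u|$ equals $n$ (values $L_i(u)$ with $i>N(u)$ play no role). The initial particle $\emptyset$ is at $S_\emptyset=0$; each particle $u$ of generation $n$, located at $S_u$, is replaced by $N(u)$ particles $ui$ of generation $n+1$ located at $S_{ui}=S_u+L_i(u)$, $1\le i\le N(u)$. Let $\mathbb{T}_n$ be the set of particles of generation $n$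 and $Z_n=\sum_{u\in\mathbb{T}_n}\delta_{S_u}$ their counting measure. The annealed law $\mathbb{P}$ (expectation $\mathbb{E}$) is $\mathbb{P}_\xi$ integrated against the law of $\xi$. Write $N=N(\emptyset)$, $L_i=L_i(\emptyset)$, and $m_n=\mathbb{E}_\xi N(u)$ for $|u|=n$. Standing assumption: $\mathbb{E}\log m_0\in(0,\infty)$ and $\mathbb{E}\frac{N}{m_0}\log^+N<\infty$. Notation: $m_0(t)=\mathbb{E}_\xi\sum_{i=1}^{N}e^{tL_i}$, $\Lambda_a(t)=\log\mathbb{E}m_0(t)$, and $\Lambda_a^*(x)=\sup_{t\in\mathbb{R}}\{xt-\Lambda_a(t)\}$ is its Legendre transform. Also $nA=\{nx:x\in A\}$; $\log0=-\infty$ and $\inf\emptyset=+\infty$. *)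

theory Defs
  imports "HOL-Probability.Probability"
begin

section \<open>Stationary and ergodic sequences\<close>

definition path_space :: "'th measure \<Rightarrow> (nat \<Rightarrow> 'th) measure" where
  "path_space \<Theta> = PiM UNIV (\<lambda>_. \<Theta>)"

definition path_law :: "'w measure \<Rightarrow> 'th measure \<Rightarrow> (nat \<Rightarrow> 'w \<Rightarrow> 'th) \<Rightarrow> (nat \<Rightarrow> 'th) measure" where
  "path_law M \<Theta> \<xi> = distr M (path_space \<Theta>) (\<lambda>w n. \<xi> n w)"

definition shift :: "(nat \<Rightarrow> 'th) \<Rightarrow> nat \<Rightarrow> 'th" where
  "shift x = (\<lambda>n. x (Suc n))"

definition stationary :: "'w measure \<Rightarrow> 'th measure \<Rightarrow> (nat \<Rightarrow> 'w \<Rightarrow> 'th) \<Rightarrow> bool" where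
  "stationary M \<Theta> \<xi> \<longleftrightarrow> distr (path_law M \<Theta> \<xi>) (path_space \<Theta>) shift = path_law M \<Theta> \<xi>"

definition ergodic :: "'w measure \<Rightarrow> 'th measure \<Rightarrow> (nat \<Rightarrow> 'w \<Rightarrow> 'th) \<Rightarrow> bool" where
  "ergodic M \<Theta> \<xi> \<longleftrightarrow>
     (\<forall>A\<in>sets (path_space \<Theta>). shift -` A \<inter> space (path_space \<Theta>) = A \<longrightarrow>
        emeasure (path_law M \<Theta> \<xi>) A = 0 \<or> emeasure (path_law M \<Theta> \<xi>) A = 1)"

definition iid :: "'w measure \<Rightarrow> 'th measure \<Rightarrow> (nat \<Rightarrow> 'w \<Rightarrow> 'th) \<Rightarrow> bool" where
  "iid M \<Theta> \<xi> \<longleftrightarrow> prob_space.indep_vars M (\<lambda>_. \<Theta>) \<xi> UNIV \<and>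
     (\<forall>n. distr M \<Theta> (\<xi> n) = distr M \<Theta> (\<xi> 0))"


section \<open>Branching random walk in a random environment in time\<close>

text \<open>A pair \<open>(N, L)\<close> is the offspring vector of one particle. Children are numbered from 0, so
  \<open>L i\<close> is the displacement usually written with index \<open>i + 1\<close>, and the relevant indices are
  \<open>i < N\<close>.\<close>

type_synonym offspring = "nat \<times> (nat \<Rightarrow> real)"

text \<open>A particle is named by its line of descent, most recent index first: the \<open>i\<close>-th child of
  \<open>u\<close> is \<open>i # u\<close>, the initial particle is \<open>[]\<close>, and \<open>length u\<close> is the generation.\<close>

type_synonym particle = "nat list"

type_synonym marks = "particle \<Rightarrow> offspring"

definition offspring_space :: "offspring measure" where
  "offspring_space = count_space UNIV \<Otimes>\<^sub>M PiM UNIV (\<lambda>_. borel)"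

definition marks_space :: "marks measure" where
  "marks_space = PiM UNIV (\<lambda>_. offspring_space)"

definition random_environment ::
  "'w measure \<Rightarrow> 'th measure \<Rightarrow> (nat \<Rightarrow> 'w \<Rightarrow> 'th) \<Rightarrow> ('th \<Rightarrow> offspring measure) \<Rightarrow> bool" where
  "random_environment M \<Theta> \<xi> \<eta> \<longleftrightarrow>
     prob_space M \<and> (\<forall>n. \<xi> n \<in> M \<rightarrow>\<^sub>M \<Theta>) \<and> stationary M \<Theta> \<xi> \<and> ergodic M \<Theta> \<xi> \<and>
     \<eta> \<in> \<Theta> \<rightarrow>\<^sub>M prob_algebra offspring_space"

definition quenched_law :: "('th \<Rightarrow> offspring measure) \<Rightarrow> (nat \<Rightarrow> 'th) \<Rightarrow> marks measure" where
  "quenched_law \<eta> x = PiM UNIV (\<lambda>u. \<eta> (x (length u)))"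

text \<open>The annealed law is carried by pairs of an environment and a family of offspring vectors.\<close>

definition annealed_law ::
  "'w measure \<Rightarrow> 'th measure \<Rightarrow> (nat \<Rightarrow> 'w \<Rightarrow> 'th) \<Rightarrow> ('th \<Rightarrow> offspring measure) \<Rightarrow>
     ((nat \<Rightarrow> 'th) \<times> marks) measure" where
  "annealed_law M \<Theta> \<xi> \<eta> =
     path_law M \<Theta> \<xi> \<bind> (\<lambda>x. quenched_law \<eta> x \<bind>
       (\<lambda>X. return (path_space \<Theta> \<Otimes>\<^sub>M marks_space) (x, X)))"

primrec generation :: "marks \<Rightarrow> nat \<Rightarrow> particle set" where
  "generation X 0 = {[]}"
| "generation X (Suc n) = {i # u | i u. u \<in> generation X n \<and> i < fst (X u)}"

primrec position :: "marks \<Rightarrow> particle \<Rightarrow> real" where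
  "position X [] = 0"
| "position X (i # u) = position X u + snd (X u) i"

definition Z :: "marks \<Rightarrow> nat \<Rightarrow> real set \<Rightarrow> ennreal" where
  "Z X n B = (\<Sum>u\<in>generation X n. emeasure (return borel (position X u)) B)"

definition m0 :: "('th \<Rightarrow> offspring measure) \<Rightarrow> (nat \<Rightarrow> 'th) \<Rightarrow> ennreal" where
  "m0 \<eta> x = (\<integral>\<^sup>+X. of_nat (fst (X [])) \<partial>quenched_law \<eta> x)"

definition m0_exp :: "('th \<Rightarrow> offspring measure) \<Rightarrow> (nat \<Rightarrow> 'th) \<Rightarrow> real \<Rightarrow> ennreal" where
  "m0_exp \<eta> x t =
     (\<integral>\<^sup>+X. (\<Sum>i<fst (X []). ennreal (exp (t * snd (X []) i))) \<partial>quenched_law \<eta> x)"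

text \<open>In \<open>log_plus\<close> the value at 0 is 0, since \<open>ln 0 = 0\<close>.\<close>

definition log_plus :: "real \<Rightarrow> real" where
  "log_plus y = max 0 (ln y)"

text \<open>From here on \<open>P\<close> stands for the annealed law. The first three conjuncts of
  the standing assumption express that the expectation of \<open>log m\<^sub>0\<close>, with \<open>log 0 = -\<infinity>\<close> and
  \<open>log \<infinity> = \<infinity>\<close>, exists and lies in \<open>(0, \<infinity>)\<close>.\<close>

definition standing_assumption ::
  "('th \<Rightarrow> offspring measure) \<Rightarrow> ((nat \<Rightarrow> 'th) \<times> marks) measure \<Rightarrow> bool" where
  "standing_assumption \<eta> P \<longleftrightarrow>
     (AE (x, X) in P. 0 < m0 \<eta> x \<and> m0 \<eta> x < \<infinity>) \<and>
     integrable P (\<lambda>(x, X). ln (enn2real (m0 \<eta> x))) \<and>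
     0 < (\<integral>(x, X). ln (enn2real (m0 \<eta> x)) \<partial>P) \<and>
     (\<integral>\<^sup>+(x, X). of_nat (fst (X [])) / m0 \<eta> x * ennreal (log_plus (real (fst (X [])))) \<partial>P) < \<infinity>"

definition mean_Z ::
  "((nat \<Rightarrow> 'th) \<times> marks) measure \<Rightarrow> nat \<Rightarrow> real set \<Rightarrow> ennreal" where
  "mean_Z P n B = (\<integral>\<^sup>+(x, X). Z X n B \<partial>P)"


section \<open>Logarithm and Legendre transform with values in the extended reals\<close>

definition elog :: "ennreal \<Rightarrow> ereal" where
  "elog y = (if y = 0 then -\<infinity> else if y = \<infinity> then \<infinity> else ereal (ln (enn2real y)))"

definition legendre :: "(real \<Rightarrow> ereal) \<Rightarrow> real \<Rightarrow> ereal" where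
  "legendre f x = (SUP t::real. ereal (x * t) - f t)"

definition mean_m0_exp ::
  "('th \<Rightarrow> offspring measure) \<Rightarrow> ((nat \<Rightarrow> 'th) \<times> marks) measure \<Rightarrow> real \<Rightarrow> ennreal" where
  "mean_m0_exp \<eta> P t = (\<integral>\<^sup>+(x, X). m0_exp \<eta> x t \<partial>P)"

definition Lambda_a ::
  "('th \<Rightarrow> offspring measure) \<Rightarrow> ((nat \<Rightarrow> 'th) \<times> marks) measure \<Rightarrow> real \<Rightarrow> ereal" where
  "Lambda_a \<eta> P t = elog (mean_m0_exp \<eta> P t)"

text \<open>Large deviation principle for finite measures on the line, in the form of the two bounds
  for every Borel set. The measures need not be probabilities, so \<open>I\<close> may take negative values.
  The infimum over the empty set is \<open>\<infinity>\<close>.\<close>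

definition large_deviation_bounds :: "(nat \<Rightarrow> real set \<Rightarrow> ennreal) \<Rightarrow> (real \<Rightarrow> ereal) \<Rightarrow> bool" where
  "large_deviation_bounds \<mu> I \<longleftrightarrow> (\<forall>A\<in>sets borel.
      - (INF x\<in>interior A. I x) \<le> liminf (\<lambda>n. ereal (1 / real n) * elog (\<mu> n A)) \<and>
      liminf (\<lambda>n. ereal (1 / real n) * elog (\<mu> n A))
        \<le> limsup (\<lambda>n. ereal (1 / real n) * elog (\<mu> n A)) \<and>
      limsup (\<lambda>n. ereal (1 / real n) * elog (\<mu> n A)) \<le> - (INF x\<in>closure A. I x))"

end

theory Submission
  imports Defs
begin

text \<open>Because the environment is i.i.d., the mean \<open>E Z\<^sub>n\<close> is the \<open>n\<close>-th convolution power of the mean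
  offspring measure \<open>\<nu> = E Z\<^sub>1\<close>, whose Laplace transform is \<open>E m\<^sub>0(t)\<close>. The statement is therefore
  Cramer's theorem for a finite measure \<open>\<nu>\<close> with all exponential moments. The convolution identity
  follows by resampling: first the offspring vectors of generation \<open>n\<close>, then \<open>\<xi>\<^sub>n\<close>, of which the
  first \<open>n\<close> generations do not depend. The upper bound is Chernoff's inequality together with
  compactness. For the lower bound at \<open>x\<close>, let \<open>\<phi>(t) = \<integral> exp (t (y - x)) \<nu>(dy)\<close>. If \<open>\<nu>\<close> charges both
  sides of \<open>x\<close>, take \<open>t\<close> almost minimising \<open>\<phi>\<close>; the estimate
  \<open>\<phi>(t + s) + \<phi>(t - s) \<le> 2 \<phi>(t) + O(s\<^sup>2)\<close> then shows that the window around \<open>n x\<close> carries most of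
  \<open>\<integral> exp (t (y - n x)) \<nu>\<^sup>*\<^sup>n(dy) = \<phi>(t)\<^sup>n\<close>. Otherwise \<open>inf \<phi> = \<nu>{x}\<close>, and the bound
  \<open>\<nu>\<^sup>*\<^sup>n{n x} \<ge> \<nu>{x}\<^sup>n\<close> suffices.\<close>

section \<open>Exponential rates\<close>

lemma elog_mono: "a \<le> b \<Longrightarrow> elog a \<le> elog b"
proof (cases "a = 0 \<or> b = \<infinity>")
  case True
  then show ?thesis by (auto simp: elog_def)
next
  case False
  moreover assume "a \<le> b"
  ultimately obtain r s where "a = ennreal r" "0 < r" "b = ennreal s" "r \<le> s"
    by (cases a; cases b) (auto simp: top_unique)
  then show ?thesis by (simp add: elog_def)
qed

lemma elog_ennreal: "0 < r \<Longrightarrow> elog (ennreal r) = ereal (ln r)"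
  by (simp add: elog_def)

lemma tendsto_const_mult_exp_rate:
  assumes "c > 0"
  shows "(\<lambda>n. ereal (1 / real n) * elog (ennreal (c * exp (real n * b)))) \<longlonglongrightarrow> ereal b"
proof -
  have "(\<lambda>n. ln c / real n + b) \<longlonglongrightarrow> 0 + b"
    by (intro tendsto_add tendsto_const lim_const_over_n)
  then have "(\<lambda>n. ereal (ln c / real n + b)) \<longlonglongrightarrow> ereal b"
    by simp
  then show ?thesis
  proof (rule Lim_transform_eventually)
    show "\<forall>\<^sub>F n in sequentially. ereal (ln c / real n + b)
      = ereal (1 / real n) * elog (ennreal (c * exp (real n * b)))"
      \<comment> \<open>Only eventually: at \<open>n = 0\<close> the right-hand side is 0, because
        \<open>1 / real 0 = 0\<close>, while the left-hand side is \<open>b\<close>.\<close>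
      using eventually_gt_at_top[of 0]
      by eventually_elim (use assms in \<open>simp add: elog_ennreal ln_mult add_divide_distrib\<close>)
  qed
qed

lemma limsup_elog_le:
  assumes "c > 0" and "\<forall>\<^sub>F n in sequentially. a n \<le> ennreal (c * exp (real n * b))"
  shows "limsup (\<lambda>n. ereal (1 / real n) * elog (a n)) \<le> ereal b"
proof -
  have "limsup (\<lambda>n. ereal (1 / real n) * elog (a n))
      \<le> limsup (\<lambda>n. ereal (1 / real n) * elog (ennreal (c * exp (real n * b))))"
    by (intro Limsup_mono eventually_mono[OF assms(2)] ereal_mult_left_mono elog_mono) auto
  also have "\<dots> = ereal b"
    by (intro lim_imp_Limsup tendsto_const_mult_exp_rate assms) simp
  finally show ?thesis .
qed

lemma le_liminf_elog:
  assumes "c > 0" and "\<forall>\<^sub>F n in sequentially. ennreal (c * exp (real n * b)) \<le> a n"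
  shows "ereal b \<le> liminf (\<lambda>n. ereal (1 / real n) * elog (a n))"
proof -
  have "ereal b = liminf (\<lambda>n. ereal (1 / real n) * elog (ennreal (c * exp (real n * b))))"
    by (intro lim_imp_Liminf[symmetric] tendsto_const_mult_exp_rate assms) simp
  also have "\<dots> \<le> liminf (\<lambda>n. ereal (1 / real n) * elog (a n))"
    by (intro Liminf_mono eventually_mono[OF assms(2)] ereal_mult_left_mono elog_mono) auto
  finally show ?thesis .
qed

text \<open>Reduces an upper bound by \<open>- I\<close> to real levels strictly below
  \<open>I\<close>. The case \<open>I = \<infinity>\<close>, where the claim is
  \<open>L = -\<infinity>\<close>, is treated on the same footing.\<close>

lemma le_uminusI_dense:
  fixes L I :: ereal
  assumes "\<And>\<alpha>. ereal \<alpha> < I \<Longrightarrow> L \<le> ereal (- \<alpha>)"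
  shows "L \<le> - I"
proof -
  have "I \<le> - L"
  proof (rule ccontr)
    assume "\<not> I \<le> - L"
    then obtain \<alpha> where "- L < ereal \<alpha>" "ereal \<alpha> < I"
      using ereal_dense2[of "- L" I] by (auto simp: not_le)
    with assms[of \<alpha>] show False by (cases L) auto
  qed
  then show ?thesis by (metis ereal_minus_le_minus ereal_uminus_uminus)
qed

text \<open>The preimage form gives access to measurability and to image measures. At
  \<open>n = 0\<close> it is false in general, since the image collapses to
  \<open>{0}\<close>.\<close>

lemma dilation_eq_vimage:
  "n \<noteq> 0 \<Longrightarrow> (\<lambda>x. real n * x) ` A = (\<lambda>y. y / real n) -` A"
  by (auto simp: image_iff intro!: bexI[of _ "y / real n" for y])

lemma sets_dilation:
  assumes "A \<in> sets borel" "n \<noteq> 0" shows "(\<lambda>x. real n * x) ` A \<in> sets borel"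
proof -
  have "(\<lambda>y. y / real n) -` A \<inter> space borel \<in> sets borel"
    by (rule measurable_sets[OF _ assms(1)]) simp
  then show ?thesis using assms by (simp add: dilation_eq_vimage)
qed

section \<open>Convolution powers\<close>

text \<open>The new factor stands on the right: it is the last displacement, the one that the
  recursion for the branching random walk peels off.\<close>

definition conv_pow :: "real measure \<Rightarrow> nat \<Rightarrow> real measure" where
  "conv_pow \<nu> n = ((\<lambda>\<rho>. convolution \<rho> \<nu>) ^^ n) (return borel 0)"

lemma conv_pow_0: "conv_pow \<nu> 0 = return borel 0"
  and conv_pow_Suc: "conv_pow \<nu> (Suc n) = convolution (conv_pow \<nu> n) \<nu>"
  by (simp_all add: conv_pow_def)

locale finite_borel_measure = finite_measure \<nu> for \<nu> :: "real measure" +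
  assumes sets_eq [measurable_cong, simp]: "sets \<nu> = sets borel"
begin

lemma space_eq [simp]: "space \<nu> = UNIV"
  using sets_eq_imp_space_eq[OF sets_eq] by simp

lemma sets_conv_pow [measurable_cong, simp]: "sets (conv_pow \<nu> n) = sets borel"
  by (cases n) (simp_all add: conv_pow_0 conv_pow_Suc)

lemma space_conv_pow [simp]: "space (conv_pow \<nu> n) = UNIV"
  using sets_eq_imp_space_eq[OF sets_conv_pow] by simp

lemma finite_measure_conv_pow: "finite_measure (conv_pow \<nu> n)"
proof (induction n)
  case 0
  then show ?case
    by (simp add: conv_pow_0 prob_space.finite_measure prob_space_return)
next
  case (Suc n)
  then show ?case
    by (simp add: conv_pow_Suc convolution_finite finite_measure_axioms)
qed

lemma nn_integral_conv_pow_0: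
  "f \<in> borel_measurable borel \<Longrightarrow> (\<integral>\<^sup>+y. f y \<partial>conv_pow \<nu> 0) = f 0"
  by (simp add: conv_pow_0 nn_integral_return)

lemma nn_integral_conv_pow_Suc:
  assumes "f \<in> borel_measurable borel"
  shows "(\<integral>\<^sup>+y. f y \<partial>conv_pow \<nu> (Suc n)) = (\<integral>\<^sup>+s. \<integral>\<^sup>+y. f (s + y) \<partial>\<nu> \<partial>conv_pow \<nu> n)"
  unfolding conv_pow_Suc
  by (rule nn_integral_convolution) (use assms finite_measure_conv_pow finite_measure_axioms in auto)

text \<open>The exponential of a sum factorises, and the centring \<open>n x\<close> splits into one
  \<open>x\<close> for each of the \<open>n\<close> summands.\<close>

lemma nn_integral_exp_conv_pow:
  "(\<integral>\<^sup>+y. ennreal (exp (t * (y - real n * x))) \<partial>conv_pow \<nu> n)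
    = (\<integral>\<^sup>+y. ennreal (exp (t * (y - x))) \<partial>\<nu>) ^ n"
proof (induction n)
  case 0
  then show ?case by (simp add: nn_integral_conv_pow_0)
next
  case (Suc n)
  have "ennreal (exp (t * ((s + y) - real (Suc n) * x)))
      = ennreal (exp (t * (s - real n * x))) * ennreal (exp (t * (y - x)))" for s y
    by (simp add: ennreal_mult'[symmetric] exp_add[symmetric] ring_distribs)
  then show ?case
    by (simp add: nn_integral_conv_pow_Suc nn_integral_cmult nn_integral_multc Suc.IH mult.commute[of "_ ^ n"]
      del: of_nat_Suc)
qed

text \<open>If all \<open>n\<close> summands equal \<open>x\<close>, then their sum is
  \<open>n x\<close>.\<close>

lemma emeasure_singleton_conv_pow:
  "emeasure \<nu> {x} ^ n \<le> emeasure (conv_pow \<nu> n) {real n * x}"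
proof (induction n)
  case 0
  then show ?case by (simp add: conv_pow_0)
next
  case (Suc n)
  have "emeasure (conv_pow \<nu> (Suc n)) {real (Suc n) * x}
      = (\<integral>\<^sup>+s. \<integral>\<^sup>+y. indicator {real (Suc n) * x} (s + y) \<partial>\<nu> \<partial>conv_pow \<nu> n)"
    by (subst nn_integral_conv_pow_Suc[symmetric]) simp_all
  also have "\<dots> \<ge> (\<integral>\<^sup>+s. \<integral>\<^sup>+y. indicator {real n * x} s * indicator {x} y \<partial>\<nu> \<partial>conv_pow \<nu> n)"
    by (intro nn_integral_mono) (auto split: split_indicator simp: algebra_simps)
  also have "(\<integral>\<^sup>+s. \<integral>\<^sup>+y. indicator {real n * x} s * indicator {x} y \<partial>\<nu> \<partial>conv_pow \<nu> n)
      = emeasure \<nu> {x} * emeasure (conv_pow \<nu> n) {real n * x}"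
    by (simp add: nn_integral_cmult nn_integral_multc mult.commute)
  finally show ?case
    using mult_left_mono[OF Suc, of "emeasure \<nu> {x}"] by simp
qed

end

section \<open>Cramer's theorem for finite measures\<close>

text \<open>Convexity of \<open>sinh\<close> on the nonnegative half line, where it starts at 0: the
  difference of the two sides has derivative \<open>s * (cosh v - cosh (s * v))\<close>, which is
  nonnegative since \<open>s \<le> 1\<close>.\<close>

lemma sinh_mult_le:
  fixes s w :: real
  assumes "0 \<le> s" "s \<le> 1" "0 \<le> w"
  shows "sinh (s * w) \<le> s * sinh w"
proof -
  have "s * sinh 0 - sinh (s * 0) \<le> s * sinh w - sinh (s * w)"
  proof (rule DERIV_nonneg_imp_nondecreasing[OF assms(3)])
    fix v :: real assume v: "0 \<le> v" "v \<le> w"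
    have "((\<lambda>v. s * sinh v - sinh (s * v)) has_real_derivative s * cosh v - cosh (s * v) * s) (at v)"
      by (auto intro!: derivative_eq_intros)
    moreover have "cosh (s * v) \<le> cosh v"
      using assms v by (subst cosh_real_nonneg_le_iff) (auto intro: mult_left_le_one_le)
    ultimately show "\<exists>y. ((\<lambda>v. s * sinh v - sinh (s * v)) has_real_derivative y) (at v) \<and> 0 \<le> y"
      using assms by (intro exI[of _ "s * cosh v - cosh (s * v) * s"])
        (auto simp: mult.commute intro: mult_left_mono)
  qed
  then show ?thesis by simp
qed

text \<open>At half the argument, \<open>cosh (2 * v) = 1 + 2 * (sinh v)^2\<close> turns the linear
  estimate for \<open>sinh\<close> into a quadratic one. Convexity of \<open>cosh\<close> alone
  would give the factor \<open>s\<close> in place of its square, too weak for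
  \<open>near_minimizer\<close>.\<close>

lemma cosh_mult_le:
  fixes s z :: real
  assumes "0 \<le> s" "s \<le> 1"
  shows "cosh (s * z) \<le> 1 + s\<^sup>2 * (cosh z - 1)"
proof -
  define w where "w = \<bar>z\<bar> / 2"
  have double: "cosh (2 * v) = 1 + 2 * (sinh v)\<^sup>2" for v :: real
    using cosh_double[of v] cosh_square_eq[of v] by simp
  have "(sinh (s * w))\<^sup>2 \<le> (s * sinh w)\<^sup>2"
    using assms by (intro power_mono sinh_mult_le) (auto simp: w_def)
  then have "cosh (2 * (s * w)) \<le> 1 + s\<^sup>2 * (cosh (2 * w) - 1)"
    by (simp add: double power_mult_distrib)
  moreover have "cosh (2 * (s * w)) = cosh (s * z)" "cosh (2 * w) = cosh z"
    by (auto simp: w_def abs_if)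
  ultimately show ?thesis by simp
qed

lemma exp_second_difference_le:
  fixes s t z :: real
  assumes "0 \<le> s" "s \<le> 1"
  shows "exp ((t + s) * z) + exp ((t - s) * z)
    \<le> 2 * exp (t * z) + s\<^sup>2 * (exp ((t + 1) * z) + exp ((t - 1) * z))"
proof -
  have e: "exp ((t + r) * z) + exp ((t - r) * z) = 2 * exp (t * z) * cosh (r * z)" for r
  proof -
    have "exp ((t + r) * z) = exp (t * z) * exp (r * z)" "exp ((t - r) * z) = exp (t * z) * exp (- (r * z))"
      by (simp_all add: exp_add[symmetric] left_diff_distrib distrib_right)
    then show ?thesis
      by (simp add: cosh_def distrib_left)
  qed
  have "2 * exp (t * z) * cosh (s * z) \<le> 2 * exp (t * z) * (1 + s\<^sup>2 * cosh (1 * z))"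
    using cosh_mult_le[OF assms, of z] zero_le_power2[of s]
    by (intro mult_left_mono) (simp_all only: right_diff_distrib mult_1, simp_all)
  then show ?thesis
    unfolding e by (simp add: algebra_simps)
qed

text \<open>At a point \<open>t\<close> where \<phi> almost attains its infimum \<open>m\<close>,
  neither neighbour can be much larger than \<open>\<phi> t\<close>: the second difference is small,
  so the opposite neighbour would have to fall below \<open>m\<close>. The excess is made smaller
  than \<open>s * \<delta> * \<phi> t\<close>, hence is absorbed by the factor
  \<open>exp (s * \<delta>)\<close>.\<close>

lemma near_minimizer:
  fixes \<phi> :: "real \<Rightarrow> real"
  assumes "0 < p" and lower: "\<And>t. p \<le> \<phi> t"
    and second_difference: "\<And>t s. 0 \<le> s \<Longrightarrow> s \<le> 1 \<Longrightarrow>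
      \<phi> (t + s) + \<phi> (t - s) \<le> 2 * \<phi> t + s\<^sup>2 * (\<phi> (t + 1) + \<phi> (t - 1))"
    and bound: "\<And>t. \<bar>t\<bar> \<le> T \<Longrightarrow> \<phi> (t + 1) + \<phi> (t - 1) \<le> C"
    and far: "\<And>t. T < \<bar>t\<bar> \<Longrightarrow> \<phi> 0 \<le> \<phi> t"
    and "0 \<le> T" "0 < \<delta>"
  obtains t s where "\<bar>t\<bar> \<le> T" "0 < s"
    "\<phi> (t + s) < exp (s * \<delta>) * \<phi> t" "\<phi> (t - s) < exp (s * \<delta>) * \<phi> t"
proof -
  define m where "m = (INF t. \<phi> t)"
  have bdd: "bdd_below (range \<phi>)"
    by (rule bdd_belowI2[of _ p]) (use lower in auto)
  have m_le: "m \<le> \<phi> t" for t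
    unfolding m_def by (rule cINF_lower[OF bdd]) simp
  have "p \<le> m"
    unfolding m_def by (rule cINF_greatest) (use lower in auto)
  then have "0 < m" using \<open>0 < p\<close> by simp
  have "0 < C"
    using bound[of 0] lower[of 1] lower[of "-1"] \<open>0 \<le> T\<close> \<open>0 < p\<close> by simp
  \<comment> \<open>With this choice the quadratic error \<open>s\<^sup>2 * C\<close> is at most
    \<open>s * \<delta> * m / 4\<close>, the same size as the tolerance allowed for
    \<open>\<phi> t\<close> above \<open>m\<close>.\<close>
  define s where "s = min 1 (\<delta> * m / (4 * C))"
  have s: "0 < s" "s \<le> 1"
    using \<open>0 < m\<close> \<open>0 < C\<close> \<open>0 < \<delta>\<close> by (simp_all add: s_def)
  have "s \<le> \<delta> * m / (4 * C)" by (simp add: s_def)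
  then have "C * s \<le> \<delta> * m / 4"
    using \<open>0 < C\<close> by (simp add: field_simps)
  then have Cs: "s\<^sup>2 * C \<le> s * \<delta> * m / 4"
    using mult_left_mono[of "C * s" "\<delta> * m / 4" s] s by (simp add: power2_eq_square ac_simps)
  have "m < m + s * \<delta> * m / 4"
    using s \<open>0 < m\<close> \<open>0 < \<delta>\<close> by simp
  then obtain t0 where t0: "\<phi> t0 < m + s * \<delta> * m / 4"
    unfolding m_def[symmetric] using cINF_less_iff[OF _ bdd, of "m + s * \<delta> * m / 4"] by (auto simp: m_def)
  \<comment> \<open>A near-minimiser outside \<open>[-T, T]\<close> is replaced by 0, where \<phi>
    is no larger. So \<open>t\<close> stays in the range where the constant \<open>C\<close>
    applies.\<close>
  obtain t where t: "\<bar>t\<bar> \<le> T" "\<phi> t < m + s * \<delta> * m / 4"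
  proof (cases "\<bar>t0\<bar> \<le> T")
    case True
    then show ?thesis using t0 that by blast
  next
    case False
    then show ?thesis using t0 that[of 0] far[of t0] \<open>0 \<le> T\<close> by simp
  qed
  have sum: "\<phi> (t + s) + \<phi> (t - s) \<le> 2 * \<phi> t + s * \<delta> * m / 4"
    using second_difference[of s t] s mult_left_mono[OF bound[OF t(1)], of "s\<^sup>2"] Cs zero_le_power2[of s]
    by linarith
  have "s * \<delta> * m \<le> s * \<delta> * \<phi> t"
    using s \<open>0 < \<delta>\<close> m_le[of t] by simp
  moreover have "(1 + s * \<delta>) * \<phi> t \<le> exp (s * \<delta>) * \<phi> t"
    using \<open>0 < m\<close> m_le[of t] by (intro mult_right_mono) auto
  moreover have "0 < s * \<delta> * m" using s \<open>0 < \<delta>\<close> \<open>0 < m\<close> by simp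
  ultimately have "\<phi> t + s * \<delta> * m / 2 < exp (s * \<delta>) * \<phi> t"
    by (simp add: distrib_right)
  \<comment> \<open>Each neighbour has a value at least
    \<open>m > \<phi> t - s * \<delta> * m / 4\<close>; subtracting it from \<open>sum\<close>
    leaves less than \<open>\<phi> t + s * \<delta> * m / 2\<close> for the other.\<close>
  with sum m_le[of "t + s"] m_le[of "t - s"] t(2) show ?thesis
    by (intro that[of t s]) (use t(1) s in auto)
qed

section \<open>Centred Laplace transform and rate function\<close>

locale exponential_moments = finite_borel_measure +
  assumes nonzero: "emeasure \<nu> UNIV \<noteq> 0"
    and finite_exp: "(\<integral>\<^sup>+y. ennreal (exp (t * y)) \<partial>\<nu>) < \<infinity>"
begin

text \<open>Laplace transform of \<nu> recentred at \<open>x\<close>. Centring makes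
  \<open>- ln (mgf x t)\<close> equal to \<open>x * t - ln (mgf 0 t)\<close>, so the rate at
  \<open>x\<close> is minus the logarithm of the infimum of \<open>mgf x\<close>.\<close>

definition mgf :: "real \<Rightarrow> real \<Rightarrow> real" where
  "mgf x t = enn2real (\<integral>\<^sup>+y. ennreal (exp (t * (y - x))) \<partial>\<nu>)"

lemma nn_integral_exp_shift:
  "(\<integral>\<^sup>+y. ennreal (exp (t * (y - x))) \<partial>\<nu>)
    = ennreal (exp (- (t * x))) * (\<integral>\<^sup>+y. ennreal (exp (t * y)) \<partial>\<nu>)"
  by (subst nn_integral_cmult[symmetric])
    (auto simp: ennreal_mult'[symmetric] exp_add[symmetric] right_diff_distrib intro!: nn_integral_cong)

lemma ennreal_mgf: "(\<integral>\<^sup>+y. ennreal (exp (t * (y - x))) \<partial>\<nu>) = ennreal (mgf x t)"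
  unfolding mgf_def nn_integral_exp_shift using finite_exp[of t]
  by (intro ennreal_enn2real[symmetric]) (simp add: ennreal_mult_less_top)

lemma mgf_pos: "0 < mgf x t"
proof -
  have "(\<integral>\<^sup>+y. ennreal (exp (t * (y - x))) \<partial>\<nu>) \<noteq> 0"
  proof
    assume "(\<integral>\<^sup>+y. ennreal (exp (t * (y - x))) \<partial>\<nu>) = 0"
    then have "AE y in \<nu>. False"
      by (subst (asm) nn_integral_0_iff_AE) (auto simp: ennreal_eq_0_iff not_le)
    then show False
      using nonzero by (simp add: AE_iff_measurable[OF _ refl])
  qed
  then show ?thesis
    by (simp add: ennreal_mgf ennreal_eq_0_iff)
qed

lemma mgf_shift: "mgf x t = exp (- (t * x)) * mgf 0 t"
proof -
  have "ennreal (mgf x t) = ennreal (exp (- (t * x)) * mgf 0 t)"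
    using nn_integral_exp_shift[of t x] ennreal_mgf[of t x] ennreal_mgf[of t 0]
    by (simp add: ennreal_mult')
  then show ?thesis
    using mgf_pos[of x t] mgf_pos[of 0 t] by (subst (asm) ennreal_inj) (auto intro: less_imp_le)
qed

lemma neg_ln_mgf: "- ln (mgf x t) = x * t - ln (mgf 0 t)"
  using mgf_pos[of 0 t] by (subst mgf_shift) (simp add: ln_mult)

definition rate :: "real \<Rightarrow> ereal" where
  "rate = legendre (\<lambda>t. elog (\<integral>\<^sup>+y. ennreal (exp (t * y)) \<partial>\<nu>))"

lemma rate_eq: "rate x = (SUP t. ereal (- ln (mgf x t)))"
proof -
  have "elog (\<integral>\<^sup>+y. ennreal (exp (t * y)) \<partial>\<nu>) = ereal (ln (mgf 0 t))" for t
    using ennreal_mgf[of t 0] by (simp add: elog_ennreal mgf_pos)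
  then show ?thesis
    unfolding rate_def legendre_def neg_ln_mgf by simp
qed

lemma neg_rate_le: "- rate x \<le> ereal (ln (mgf x t))"
proof -
  have "ereal (- ln (mgf x t)) \<le> rate x"
    unfolding rate_eq by (rule SUP_upper) simp
  then show ?thesis by (cases "rate x") auto
qed

lemma mgf_second_difference:
  assumes "0 \<le> s" "s \<le> 1"
  shows "mgf x (t + s) + mgf x (t - s) \<le> 2 * mgf x t + s\<^sup>2 * (mgf x (t + 1) + mgf x (t - 1))"
proof -
  have nonneg: "0 \<le> mgf x r" for r using mgf_pos[of x r] by simp
  have "ennreal (mgf x (t + s) + mgf x (t - s))
      = (\<integral>\<^sup>+y. ennreal (exp ((t + s) * (y - x)) + exp ((t - s) * (y - x))) \<partial>\<nu>)"
    by (simp add: nonneg nn_integral_add flip: ennreal_mgf)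
  also have "\<dots> \<le> (\<integral>\<^sup>+y. ennreal (2 * exp (t * (y - x))
      + s\<^sup>2 * (exp ((t + 1) * (y - x)) + exp ((t - 1) * (y - x)))) \<partial>\<nu>)"
    by (intro nn_integral_mono ennreal_leI exp_second_difference_le assms)
  also have "\<dots> = ennreal (2 * mgf x t + s\<^sup>2 * (mgf x (t + 1) + mgf x (t - 1)))"
    by (simp add: nonneg nn_integral_add nn_integral_cmult ennreal_mult flip: ennreal_mgf)
  finally show ?thesis
    by (subst (asm) ennreal_le_iff) (auto intro!: add_nonneg_nonneg mult_nonneg_nonneg nonneg)
qed

text \<open>Pointwise, \<open>exp (t * z) \<le> exp (T * \<bar>z\<bar>)\<close>, and this is one of
  the two exponentials on the right. The result is a bound uniform in \<open>t\<close> on a compact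
  interval, as \<open>near_minimizer\<close> demands.\<close>

lemma mgf_mono_bound:
  assumes "\<bar>t\<bar> \<le> T"
  shows "mgf x t \<le> mgf x T + mgf x (- T)"
proof -
  have nonneg: "0 \<le> mgf x r" for r using mgf_pos[of x r] by simp
  have le: "exp (t * z) \<le> exp (T * z) + exp (- T * z)" for z
  proof -
    have "t * z \<le> \<bar>t\<bar> * \<bar>z\<bar>" by (metis abs_ge_self abs_mult)
    also have "\<dots> \<le> T * \<bar>z\<bar>" using assms by (intro mult_right_mono) auto
    finally have "exp (t * z) \<le> exp (T * \<bar>z\<bar>)" by simp
    also have "\<dots> \<le> exp (T * z) + exp (- T * z)" by (cases "0 \<le> z") auto
    finally show ?thesis .
  qed
  have "ennreal (mgf x t) \<le> (\<integral>\<^sup>+y. ennreal (exp (T * (y - x)) + exp (- T * (y - x))) \<partial>\<nu>)"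
    unfolding ennreal_mgf[symmetric] by (intro nn_integral_mono ennreal_leI le)
  also have "\<dots> = (\<integral>\<^sup>+y. ennreal (exp (T * (y - x))) \<partial>\<nu>) + (\<integral>\<^sup>+y. ennreal (exp (- T * (y - x))) \<partial>\<nu>)"
    by (simp add: nn_integral_add)
  also have "\<dots> = ennreal (mgf x T + mgf x (- T))"
    unfolding ennreal_mgf by (simp add: nonneg)
  finally show ?thesis
    by (subst (asm) ennreal_le_iff) (auto intro!: add_nonneg_nonneg nonneg)
qed

section \<open>Upper bound\<close>

text \<open>The exponential Markov inequality. For \<open>t \<noteq> 0\<close> the set is a half
  line, on whose dilation \<open>q * exp (t * y)\<close> is at least 1; the factor \<open>q\<close>
  is chosen so that the integral of this function is exactly
  \<open>exp (- (n * \<alpha>))\<close>.\<close>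

lemma chernoff:
  assumes "n \<noteq> 0"
  shows "emeasure (conv_pow \<nu> n) ((\<lambda>x. real n * x) ` {x. \<alpha> < - ln (mgf x t)})
    \<le> ennreal (exp (- (real n * \<alpha>)))"
proof -
  define q where "q = exp (- (real n * \<alpha>)) / mgf 0 t ^ n"
  have "0 \<le> q" using mgf_pos[of 0 t] by (simp add: q_def)
  have S: "{x. \<alpha> < - ln (mgf x t)} \<in> sets borel"
    unfolding neg_ln_mgf by measurable
  have le: "1 \<le> q * exp (t * y)" if "\<alpha> < - ln (mgf (y / real n) t)" for y
  proof -
    have "real n * \<alpha> \<le> real n * (y / real n * t - ln (mgf 0 t))"
      using that unfolding neg_ln_mgf by (intro mult_left_mono) auto
    then have "real n * \<alpha> + real n * ln (mgf 0 t) \<le> t * y"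
      using assms by (simp add: right_diff_distrib mult.commute)
    then have "exp (real n * \<alpha>) * exp (real n * ln (mgf 0 t)) \<le> exp (t * y)"
      by (simp flip: exp_add)
    moreover have "exp (real n * ln (mgf 0 t)) = mgf 0 t ^ n"
      using mgf_pos[of 0 t] by (simp add: exp_of_nat_mult)
    ultimately show ?thesis
      using mgf_pos[of 0 t] by (simp add: q_def exp_minus divide_simps mult.commute)
  qed
  have "emeasure (conv_pow \<nu> n) ((\<lambda>x. real n * x) ` {x. \<alpha> < - ln (mgf x t)})
      = (\<integral>\<^sup>+y. indicator ((\<lambda>x. real n * x) ` {x. \<alpha> < - ln (mgf x t)}) y \<partial>conv_pow \<nu> n)"
    by (rule nn_integral_indicator[symmetric]) (use sets_dilation[OF S assms] in simp)
  also have "\<dots> \<le> (\<integral>\<^sup>+y. ennreal q * ennreal (exp (t * y)) \<partial>conv_pow \<nu> n)"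
    using le \<open>0 \<le> q\<close> unfolding dilation_eq_vimage[OF assms]
    by (intro nn_integral_mono)
      (auto split: split_indicator simp: ennreal_mult'[symmetric] simp flip: ennreal_1 intro!: ennreal_leI)
  also have "\<dots> = ennreal (q * mgf 0 t ^ n)"
    using nn_integral_exp_conv_pow[of n t 0] ennreal_mgf[of t 0] mgf_pos[of 0 t] \<open>0 \<le> q\<close>
    by (simp add: nn_integral_cmult ennreal_power ennreal_mult')
  also have "q * mgf 0 t ^ n = exp (- (real n * \<alpha>))"
    using mgf_pos[of 0 t] by (simp add: q_def)
  finally show ?thesis .
qed

text \<open>A point of rate above \<alpha> lies in one of the open sets of \<open>chernoff\<close>.
  Finitely many of them cover the closure of \<open>A\<close>, and their number, being independent
  of \<open>n\<close>, does not affect the exponential rate.\<close>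

lemma upper_bound:
  assumes "A \<in> sets borel"
  shows "limsup (\<lambda>n. ereal (1 / real n) * elog (emeasure (conv_pow \<nu> n) ((\<lambda>x. real n * x) ` A)))
    \<le> - (INF x\<in>closure A. rate x)"
proof -
  let ?a = "\<lambda>n. emeasure (conv_pow \<nu> n) ((\<lambda>x. real n * x) ` A)"
  let ?U = "\<lambda>\<alpha> t. {x. \<alpha> < - ln (mgf x t)}"
  have le: "limsup (\<lambda>n. ereal (1 / real n) * elog (?a n)) \<le> ereal (- \<alpha>)"
    if \<alpha>: "ereal \<alpha> < (INF x\<in>closure A. rate x)" for \<alpha>
  proof -
    have cover: "closure A \<subseteq> (\<Union>t. ?U \<alpha> t)"
    proof
      fix x assume "x \<in> closure A"
      then have "ereal \<alpha> < rate x" using \<alpha> by (meson INF_lower order_less_le_trans)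
      then show "x \<in> (\<Union>t. ?U \<alpha> t)" unfolding rate_eq less_SUP_iff by auto
    qed
    define K where "K = closure A \<inter> {- (\<alpha> + ln (mgf 0 (-1))) .. \<alpha> + ln (mgf 0 1)}"
    \<comment> \<open>The half lines for \<open>t = 1\<close> and \<open>t = -1\<close> cover the complement of \<open>K\<close>, so compactness of \<open>K\<close>
      gives a finite cover of the whole closed set.\<close>
    have "compact K" unfolding K_def by (intro closed_Int_compact) auto
    moreover have "open (?U \<alpha> t)" for t
      unfolding neg_ln_mgf by (intro open_Collect_less continuous_intros)
    moreover have "K \<subseteq> (\<Union>t\<in>UNIV. ?U \<alpha> t)" using cover by (auto simp: K_def)
    ultimately obtain J0 where J0: "finite J0" "K \<subseteq> (\<Union>t\<in>J0. ?U \<alpha> t)"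
      by (rule compactE_image) auto
    define J where "J = insert 1 (insert (-1) J0)"
    have "closure A - K \<subseteq> ?U \<alpha> 1 \<union> ?U \<alpha> (-1)"
      unfolding neg_ln_mgf by (auto simp: K_def)
    with J0 have A_sub: "A \<subseteq> (\<Union>t\<in>J. ?U \<alpha> t)" and "finite J"
      using closure_subset[of A] by (auto simp: J_def)
    have sets_U: "?U \<alpha> t \<in> sets borel" for t
      unfolding neg_ln_mgf by measurable
    have "?a n \<le> ennreal (real (card J) * exp (real n * (- \<alpha>)))" if "n \<noteq> 0" for n
    proof -
      have "?a n \<le> emeasure (conv_pow \<nu> n) (\<Union>t\<in>J. (\<lambda>x. real n * x) ` ?U \<alpha> t)"
        using image_mono[OF A_sub] \<open>finite J\<close> sets_dilation[OF sets_U that]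
        by (intro emeasure_mono) (simp_all add: image_UN sets.finite_UN)
      also have "\<dots> \<le> (\<Sum>t\<in>J. emeasure (conv_pow \<nu> n) ((\<lambda>x. real n * x) ` ?U \<alpha> t))"
        using \<open>finite J\<close> sets_dilation[OF sets_U that]
        by (intro emeasure_subadditive_finite) auto
      also have "\<dots> \<le> (\<Sum>t\<in>J. ennreal (exp (- (real n * \<alpha>))))"
        by (intro sum_mono chernoff that)
      also have "\<dots> = ennreal (real (card J) * exp (real n * (- \<alpha>)))"
        by (simp add: ennreal_mult' ennreal_of_nat_eq_real_of_nat)
      finally show ?thesis .
    qed
    then have "\<forall>\<^sub>F n in sequentially. ?a n \<le> ennreal (real (card J) * exp (real n * (- \<alpha>)))"
      using eventually_gt_at_top[of 0] by (rule eventually_mono[rotated]) auto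
    moreover have "0 < real (card J)"
      using \<open>finite J\<close> by (auto simp: card_gt_0_iff J_def)
    ultimately show ?thesis by (rule limsup_elog_le[rotated])
  qed
  then show ?thesis by (rule le_uminusI_dense)
qed

section \<open>Lower bound\<close>

text \<open>The integral of \<open>exp (t * (y - n * x))\<close>, which is
  \<open>mgf x t ^ n\<close>, is split at the boundary of the window. The hypotheses on
  \<open>t + s\<close> and \<open>t - s\<close> make the two outer parts negligible, while inside
  the integrand is at most \<open>exp (\<bar>t\<bar> * n * \<delta>)\<close>. This is an exponential
  change of measure carried out by inequalities.\<close>

lemma emeasure_window_ge:
  assumes "0 < s" "0 < \<delta>"
  assumes "mgf x (t + s) < exp (s * \<delta>) * mgf x t" "mgf x (t - s) < exp (s * \<delta>) * mgf x t"
  shows "\<forall>\<^sub>F n in sequentially. ennreal (1/2 * exp (real n * (ln (mgf x t) - \<bar>t\<bar> * \<delta>)))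
    \<le> emeasure (conv_pow \<nu> n) {y. \<bar>y - real n * x\<bar> < real n * \<delta>}"
proof -
  define q where "q r = exp (- (s * \<delta>)) * mgf x r" for r :: real
  \<comment> \<open>\<open>q r ^ n\<close> will bound one outer part. A quarter for each of
    \<open>r = t + s\<close> and \<open>r = t - s\<close> leaves half of the total for the
    window.\<close>
  have ev: "\<forall>\<^sub>F n in sequentially. q r ^ n \<le> mgf x t ^ n / 4"
    if "mgf x r < exp (s * \<delta>) * mgf x t" for r
  proof -
    have "0 < q r" using mgf_pos[of x r] by (simp add: q_def)
    have "q r / mgf x t < 1"
      using that mgf_pos[of x t] by (simp add: q_def exp_minus field_simps)
    then have "(\<lambda>n. (q r / mgf x t) ^ n) \<longlonglongrightarrow> 0"
      using \<open>0 < q r\<close> mgf_pos[of x t] by (intro LIMSEQ_realpow_zero) auto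
    then have "\<forall>\<^sub>F n in sequentially. (q r / mgf x t) ^ n < 1/4"
      by (rule order_tendstoD) simp
    then show ?thesis
      by eventually_elim (use mgf_pos[of x t] in \<open>simp add: power_divide field_simps\<close>)
  qed
  show ?thesis
    using ev[OF assms(3)] ev[OF assms(4)]
  proof eventually_elim
    fix n :: nat
    assume q: "q (t + s) ^ n \<le> mgf x t ^ n / 4" "q (t - s) ^ n \<le> mgf x t ^ n / 4"
    define W where "W = {y. \<bar>y - real n * x\<bar> < real n * \<delta>}"
    have W: "W \<in> sets borel" unfolding W_def by measurable
    interpret \<rho>: finite_measure "conv_pow \<nu> n" by (rule finite_measure_conv_pow)
    have int: "(\<integral>\<^sup>+y. ennreal (exp (r * (y - real n * x))) \<partial>conv_pow \<nu> n) = ennreal (mgf x r ^ n)" for r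
      using nn_integral_exp_conv_pow[of n r x] mgf_pos[of x r] by (simp add: ennreal_mgf ennreal_power)
    \<comment> \<open>Outside the window \<open>s * \<bar>z\<bar>\<close> is at least
      \<open>s * n * \<delta>\<close>. Hence tilting by a further \<open>s\<close> in the direction
      of the sign of \<open>z\<close> pays for the factor
      \<open>exp (- (s * \<delta>)) ^ n\<close>.\<close>
    have ptw: "exp (t * z) \<le> exp (\<bar>t\<bar> * (real n * \<delta>)) * (if \<bar>z\<bar> < real n * \<delta> then 1 else 0)
        + exp (- (s * \<delta>)) ^ n * exp ((t + s) * z) + exp (- (s * \<delta>)) ^ n * exp ((t - s) * z)" for z
    proof (cases "\<bar>z\<bar> < real n * \<delta>")
      case True
      have "t * z \<le> \<bar>t\<bar> * \<bar>z\<bar>" by (metis abs_ge_self abs_mult)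
      also have "\<dots> \<le> \<bar>t\<bar> * (real n * \<delta>)" using True by (intro mult_left_mono) auto
      finally have "exp (t * z) \<le> exp (\<bar>t\<bar> * (real n * \<delta>))" by simp
      then show ?thesis using True by (simp add: add_increasing2)
    next
      case False
      have e: "exp (- (s * \<delta>)) ^ n * exp (r * z) = exp (r * z - s * (real n * \<delta>))" for r
        by (simp add: exp_of_nat_mult[symmetric] exp_add[symmetric] ac_simps)
      show ?thesis
      proof (cases "0 \<le> z")
        case True
        with False have "s * (real n * \<delta>) \<le> s * z" using assms by (intro mult_left_mono) auto
        then have "exp (t * z) \<le> exp ((t + s) * z - s * (real n * \<delta>))" by (simp add: distrib_right)
        then show ?thesis using False unfolding e by (simp add: add_increasing2)
      next
        case 2: False
        with False have "s * (real n * \<delta>) \<le> s * (- z)" using assms by (intro mult_left_mono) auto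
        then have "exp (t * z) \<le> exp ((t - s) * z - s * (real n * \<delta>))" by (simp add: left_diff_distrib)
        then show ?thesis using False unfolding e by (simp add: add_increasing)
      qed
    qed
    have "ennreal (mgf x t ^ n)
      \<le> (\<integral>\<^sup>+y. ennreal (exp (\<bar>t\<bar> * (real n * \<delta>))) * indicator W y
          + ennreal (exp (- (s * \<delta>)) ^ n) * ennreal (exp ((t + s) * (y - real n * x)))
          + ennreal (exp (- (s * \<delta>)) ^ n) * ennreal (exp ((t - s) * (y - real n * x))) \<partial>conv_pow \<nu> n)"
      unfolding int[symmetric]
    proof (intro nn_integral_mono)
      fix y :: real
      have "indicator W y = ennreal (if \<bar>y - real n * x\<bar> < real n * \<delta> then 1 else 0)"
        by (simp add: W_def)
      then show "ennreal (exp (t * (y - real n * x)))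
        \<le> ennreal (exp (\<bar>t\<bar> * (real n * \<delta>))) * indicator W y
          + ennreal (exp (- (s * \<delta>)) ^ n) * ennreal (exp ((t + s) * (y - real n * x)))
          + ennreal (exp (- (s * \<delta>)) ^ n) * ennreal (exp ((t - s) * (y - real n * x)))"
        using ennreal_leI[OF ptw[of "y - real n * x"]]
        by (simp add: ennreal_mult' del: ennreal_power)
    qed
    also have "\<dots> = ennreal (exp (\<bar>t\<bar> * (real n * \<delta>))) * emeasure (conv_pow \<nu> n) W
        + ennreal (exp (- (s * \<delta>)) ^ n) * ennreal (mgf x (t + s) ^ n)
        + ennreal (exp (- (s * \<delta>)) ^ n) * ennreal (mgf x (t - s) ^ n)"
      using W by (simp add: nn_integral_add nn_integral_cmult int del: ennreal_power)
    also have "\<dots> = ennreal (exp (\<bar>t\<bar> * (real n * \<delta>)) * measure (conv_pow \<nu> n) W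
        + q (t + s) ^ n + q (t - s) ^ n)"
      using mgf_pos[of x "t + s"] mgf_pos[of x "t - s"]
      by (simp add: \<rho>.emeasure_eq_measure q_def power_mult_distrib ennreal_mult' del: ennreal_power)
    finally have "mgf x t ^ n \<le> exp (\<bar>t\<bar> * (real n * \<delta>)) * measure (conv_pow \<nu> n) W
        + q (t + s) ^ n + q (t - s) ^ n"
      using mgf_pos[of x "t + s"] mgf_pos[of x "t - s"]
      by (subst (asm) ennreal_le_iff) (auto simp: q_def intro!: add_nonneg_nonneg)
    with q have "mgf x t ^ n / 2 \<le> exp (\<bar>t\<bar> * (real n * \<delta>)) * measure (conv_pow \<nu> n) W"
      by simp
    moreover have eq: "1/2 * exp (real n * (ln (mgf x t) - \<bar>t\<bar> * \<delta>))
        = mgf x t ^ n / 2 / exp (\<bar>t\<bar> * (real n * \<delta>))"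
      using mgf_pos[of x t]
      by (simp add: right_diff_distrib exp_diff exp_of_nat_mult[of n "ln _"] mult.left_commute)
    ultimately have "1/2 * exp (real n * (ln (mgf x t) - \<bar>t\<bar> * \<delta>)) \<le> measure (conv_pow \<nu> n) W"
      by (simp add: eq pos_divide_le_eq mult.commute)
    then show "ennreal (1/2 * exp (real n * (ln (mgf x t) - \<bar>t\<bar> * \<delta>)))
      \<le> emeasure (conv_pow \<nu> n) {y. \<bar>y - real n * x\<bar> < real n * \<delta>}"
      unfolding W_def[symmetric] \<rho>.emeasure_eq_measure by (rule ennreal_leI)
  qed
qed

text \<open>Some \<open>t\<close> is enough, because \<open>neg_rate_le\<close> holds at every
  \<open>t\<close>. Mass on both sides of \<open>x\<close> makes \<open>mgf x\<close> grow in both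
  directions, so its almost minimal values are found in a bounded interval, where
  \<open>near_minimizer\<close> and \<open>emeasure_window_ge\<close> apply.\<close>

lemma le_liminf_two_sided:
  assumes "0 < \<epsilon>" "0 < d" and A: "{x - d<..<x + d} \<subseteq> A" "A \<in> sets borel"
    and above: "emeasure \<nu> {x<..} \<noteq> 0" and below: "emeasure \<nu> {..<x} \<noteq> 0"
  shows "\<exists>t. ereal (ln (mgf x t) - \<epsilon>)
    \<le> liminf (\<lambda>n. ereal (1 / real n) * elog (emeasure (conv_pow \<nu> n) ((\<lambda>x. real n * x) ` A)))"
proof -
  \<comment> \<open>The sign \<sigma> selects the side of \<open>x\<close>. That open side is the
    union of the sets at distance more than \<open>1 / (k + 1)\<close> from \<open>x\<close> (for
    \<sigma> equal to 1 or -1), so one of them has positive mass \<open>p\<close>, and it alone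
    forces exponential growth.\<close>
  have half: "\<exists>a p. 0 < a \<and> 0 < p \<and> (\<forall>r\<ge>0. p * exp (r * a) \<le> mgf x (\<sigma> * r))"
    if nz: "emeasure \<nu> {y. 0 < \<sigma> * (y - x)} \<noteq> 0" for \<sigma>
  proof -
    have "\<exists>k. emeasure \<nu> {y. 1 / real (Suc k) < \<sigma> * (y - x)} \<noteq> 0"
    proof (rule ccontr)
      assume "\<not> ?thesis"
      then have "(\<Union>k. {y. 1 / real (Suc k) < \<sigma> * (y - x)}) \<in> null_sets \<nu>"
        by (intro null_sets_UN) (auto simp: null_sets_def)
      moreover have "(\<Union>k. {y. 1 / real (Suc k) < \<sigma> * (y - x)}) = {y. 0 < \<sigma> * (y - x)}"
      proof (intro set_eqI iffI)
        fix y assume "y \<in> {y. 0 < \<sigma> * (y - x)}"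
        then obtain k where "inverse (real (Suc k)) < \<sigma> * (y - x)"
          using reals_Archimedean by blast
        then show "y \<in> (\<Union>k. {y. 1 / real (Suc k) < \<sigma> * (y - x)})"
          by (auto simp: inverse_eq_divide)
      next
        fix y assume "y \<in> (\<Union>k. {y. 1 / real (Suc k) < \<sigma> * (y - x)})"
        then obtain k where "1 / real (Suc k) < \<sigma> * (y - x)" by blast
        then have "0 < \<sigma> * (y - x)" by (rule less_trans[rotated]) simp
        then show "y \<in> {y. 0 < \<sigma> * (y - x)}" by simp
      qed
      ultimately show False using nz by (simp add: null_sets_def)
    qed
    then obtain k where k: "emeasure \<nu> {y. 1 / real (Suc k) < \<sigma> * (y - x)} \<noteq> 0" by blast
    define a where "a = 1 / real (Suc k)"
    define B where "B = {y. a < \<sigma> * (y - x)}"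
    have B: "B \<in> sets borel" unfolding B_def by measurable
    have "0 < measure \<nu> B"
      using k by (simp add: a_def B_def less_le emeasure_eq_measure)
    moreover have "measure \<nu> B * exp (r * a) \<le> mgf x (\<sigma> * r)" if "0 \<le> r" for r
    proof -
      have "exp (r * a) \<le> exp (\<sigma> * r * (y - x))" if "y \<in> B" for y
        using that mult_left_mono[of a "\<sigma> * (y - x)" r] \<open>0 \<le> r\<close> by (simp add: B_def ac_simps)
      then have "(\<integral>\<^sup>+y. ennreal (exp (r * a)) * indicator B y \<partial>\<nu>)
          \<le> (\<integral>\<^sup>+y. ennreal (exp (\<sigma> * r * (y - x))) \<partial>\<nu>)"
        by (intro nn_integral_mono) (auto split: split_indicator intro: ennreal_leI)
      then have "ennreal (measure \<nu> B * exp (r * a)) \<le> ennreal (mgf x (\<sigma> * r))"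
        using B by (simp add: nn_integral_cmult emeasure_eq_measure ennreal_mgf ennreal_mult'
          mult.commute[of "measure _ _"])
      then show ?thesis
        using mgf_pos[of x "\<sigma> * r"] by (subst (asm) ennreal_le_iff) auto
    qed
    moreover have "0 < a" by (simp add: a_def)
    ultimately show ?thesis by blast
  qed
  have "{y. 0 < 1 * (y - x)} = {x<..}" "{y. 0 < - 1 * (y - x)} = {..<x}" by auto
  then obtain a1 p1 a2 p2 where
    pos: "0 < a1" "0 < p1" "0 < a2" "0 < p2"
    and gh: "\<forall>r\<ge>0. p1 * exp (r * a1) \<le> mgf x (1 * r)" "\<forall>r\<ge>0. p2 * exp (r * a2) \<le> mgf x (- 1 * r)"
    using half[of 1] half[of "- 1"] above below by (simp only:) blast
  have g: "p1 * exp (t * a1) \<le> mgf x t" if "0 \<le> t" for t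
    using gh(1)[rule_format, OF that] by simp
  have h: "p2 * exp (- t * a2) \<le> mgf x t" if "t \<le> 0" for t
    using gh(2)[rule_format, of "- t"] that by simp
  define a where "a = min a1 a2"
  define p where "p = min p1 p2"
  have ap: "0 < a" "0 < p" using pos by (auto simp: a_def p_def)
  have growth: "p * exp (\<bar>t\<bar> * a) \<le> mgf x t" for t
  proof (cases "0 \<le> t")
    case True
    then have "p * exp (\<bar>t\<bar> * a) \<le> p1 * exp (t * a1)"
      using pos by (intro mult_mono) (auto simp: a_def p_def intro: mult_left_mono)
    with g[OF True] show ?thesis by simp
  next
    case False
    then have "p * exp (\<bar>t\<bar> * a) \<le> p2 * exp (- t * a2)"
      using pos by (intro mult_mono) (auto simp: a_def p_def intro: mult_left_mono)
    with h[of t] False show ?thesis by simp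
  qed
  \<comment> \<open>Beyond this \<open>T\<close> the linear minorant
    \<open>p * (\<bar>t\<bar> * a)\<close> of \<open>growth\<close> already exceeds
    \<open>mgf x 0\<close>.\<close>
  define T where "T = mgf x 0 / (p * a)"
  have "0 \<le> T" using ap mgf_pos[of x 0] by (simp add: T_def)
  have far: "mgf x 0 \<le> mgf x t" if "T < \<bar>t\<bar>" for t
  proof -
    have "mgf x 0 \<le> p * (\<bar>t\<bar> * a)"
      using that ap by (simp add: T_def pos_divide_less_eq mult.left_commute mult.commute)
    also have "\<dots> \<le> p * exp (\<bar>t\<bar> * a)"
      using ap exp_ge_add_one_self[of "\<bar>t\<bar> * a"] by (intro mult_left_mono) linarith+
    finally show ?thesis using growth[of t] by simp
  qed
  have lower: "p \<le> mgf x t" for t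
  proof -
    have "p * 1 \<le> p * exp (\<bar>t\<bar> * a)"
      using ap by (intro mult_left_mono) auto
    with growth[of t] show ?thesis by simp
  qed
  have bound: "mgf x (t + 1) + mgf x (t - 1) \<le> 2 * (mgf x (T + 1) + mgf x (- (T + 1)))"
    if "\<bar>t\<bar> \<le> T" for t
  proof -
    have le: "\<bar>t + 1\<bar> \<le> T + 1" "\<bar>t - 1\<bar> \<le> T + 1" using that by linarith+
    show ?thesis
      using add_mono[OF mgf_mono_bound[OF le(1), of x] mgf_mono_bound[OF le(2), of x]]
      by (simp only: mult_2)
  qed
  \<comment> \<open>The first term keeps the window inside the dilated set; the second bounds the
    loss \<open>\<bar>t\<bar> * \<delta>\<close> by \<epsilon> for whatever \<open>t\<close> in
    \<open>[-T, T]\<close> is found afterwards.\<close>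
  define \<delta> where "\<delta> = min d (\<epsilon> / (T + 1))"
  have "0 < \<delta>" using \<open>0 \<le> T\<close> assms by (simp add: \<delta>_def)
  obtain t s where t: "\<bar>t\<bar> \<le> T" and s: "0 < s"
    "mgf x (t + s) < exp (s * \<delta>) * mgf x t" "mgf x (t - s) < exp (s * \<delta>) * mgf x t"
    by (rule near_minimizer[of p "mgf x" T "2 * (mgf x (T + 1) + mgf x (- (T + 1)))" \<delta>])
      (use ap lower mgf_second_difference bound far \<open>0 \<le> T\<close> \<open>0 < \<delta>\<close> in auto)
  have "\<bar>t\<bar> * \<delta> \<le> (T + 1) * (\<epsilon> / (T + 1))"
    using t \<open>0 < \<delta>\<close> \<open>0 \<le> T\<close> by (intro mult_mono) (auto simp: \<delta>_def)
  then have t\<delta>: "\<bar>t\<bar> * \<delta> \<le> \<epsilon>" using \<open>0 \<le> T\<close> by simp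
  have "ereal (ln (mgf x t) - \<bar>t\<bar> * \<delta>)
    \<le> liminf (\<lambda>n. ereal (1 / real n) * elog (emeasure (conv_pow \<nu> n) ((\<lambda>x. real n * x) ` A)))"
  proof (rule le_liminf_elog[of "1/2"])
    show "\<forall>\<^sub>F n in sequentially. ennreal (1/2 * exp (real n * (ln (mgf x t) - \<bar>t\<bar> * \<delta>)))
      \<le> emeasure (conv_pow \<nu> n) ((\<lambda>x. real n * x) ` A)"
      using emeasure_window_ge[OF s(1) \<open>0 < \<delta>\<close> s(2,3)] eventually_gt_at_top[of 0]
    proof eventually_elim
      fix n :: nat
      assume le: "ennreal (1/2 * exp (real n * (ln (mgf x t) - \<bar>t\<bar> * \<delta>)))
        \<le> emeasure (conv_pow \<nu> n) {y. \<bar>y - real n * x\<bar> < real n * \<delta>}" and "0 < n"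
      have "{y. \<bar>y - real n * x\<bar> < real n * \<delta>} \<subseteq> (\<lambda>x. real n * x) ` A"
      proof
        fix y assume "y \<in> {y. \<bar>y - real n * x\<bar> < real n * \<delta>}"
        moreover have "y / real n - x = (y - real n * x) / real n"
          using \<open>0 < n\<close> by (simp add: diff_divide_distrib)
        ultimately have "\<bar>y / real n - x\<bar> < \<delta>"
          using \<open>0 < n\<close> by (simp add: pos_divide_less_eq mult.commute)
        then have "\<bar>y / real n - x\<bar> < d" by (simp add: \<delta>_def)
        then have "y / real n \<in> {x - d<..<x + d}" by (auto simp: abs_less_iff)
        then show "y \<in> (\<lambda>x. real n * x) ` A"
          using A \<open>0 < n\<close> by (auto simp: dilation_eq_vimage)
      qed
      then show "ennreal (1/2 * exp (real n * (ln (mgf x t) - \<bar>t\<bar> * \<delta>)))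
        \<le> emeasure (conv_pow \<nu> n) ((\<lambda>x. real n * x) ` A)"
        using A \<open>0 < n\<close> by (intro order_trans[OF le] emeasure_mono) (auto simp: sets_dilation)
    qed
  qed simp
  with t\<delta> show ?thesis
    by (intro exI[of _ t]) (auto intro: order_trans[rotated])
qed

text \<open>All mass lies where the exponent is nonpositive, so the integrands are bounded by 1 and
  tend to the indicator of \<open>{x}\<close>; dominated convergence applies because \<nu> is
  finite.\<close>

lemma mgf_tendsto_atom:
  assumes "\<sigma> \<noteq> 0" and "AE y in \<nu>. 0 \<le> \<sigma> * (y - x)"
  shows "(\<lambda>k. mgf x (- (real k * \<sigma>))) \<longlonglongrightarrow> measure \<nu> {x}"
proof -
  have "(\<lambda>k. \<integral>\<^sup>+y. ennreal (exp (- (real k * \<sigma>) * (y - x))) \<partial>\<nu>)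
      \<longlonglongrightarrow> (\<integral>\<^sup>+y. indicator {x} y \<partial>\<nu>)"
  proof (rule nn_integral_dominated_convergence[where w = "\<lambda>_. 1"])
    show "AE y in \<nu>. ennreal (exp (- (real k * \<sigma>) * (y - x))) \<le> 1" for k
      using assms(2)
    proof eventually_elim
      case (elim y)
      then have "0 \<le> real k * (\<sigma> * (y - x))" by simp
      then show ?case by (simp add: mult.assoc flip: ennreal_1)
    qed
    show "AE y in \<nu>. (\<lambda>k. ennreal (exp (- (real k * \<sigma>) * (y - x)))) \<longlonglongrightarrow> indicator {x} y"
      using assms(2)
    proof eventually_elim
      case (elim y)
      show ?case
      proof (cases "y = x")
        case False
        with elim assms(1) have "exp (- (\<sigma> * (y - x))) < 1" by (simp add: less_le)
        then have "(\<lambda>k. exp (- (\<sigma> * (y - x))) ^ k) \<longlonglongrightarrow> 0"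
          by (intro LIMSEQ_realpow_zero) auto
        then have "(\<lambda>k. ennreal (exp (- (real k * \<sigma>) * (y - x)))) \<longlonglongrightarrow> ennreal 0"
          by (intro tendsto_ennrealI) (simp add: exp_of_nat_mult[symmetric] mult.assoc)
        then show ?thesis using False by simp
      qed simp
    qed
  qed (simp_all add: less_top[symmetric])
  then have "(\<lambda>k. ennreal (mgf x (- (real k * \<sigma>)))) \<longlonglongrightarrow> ennreal (measure \<nu> {x})"
    unfolding ennreal_mgf by (simp add: emeasure_eq_measure)
  then show ?thesis
    by (subst (asm) tendsto_ennreal_iff) (auto intro!: always_eventually less_imp_le[OF mgf_pos])
qed

text \<open>Without an atom at \<open>x\<close> the values of \<open>mgf x\<close> come arbitrarily
  close to 0, the rate is infinite and the claim is trivial. With an atom, \<open>- rate x\<close>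
  is at most the logarithm of its mass, and the single point \<open>n x\<close> carries enough
  mass.\<close>

lemma le_liminf_one_sided:
  assumes "\<sigma> \<noteq> 0" and AE: "AE y in \<nu>. 0 \<le> \<sigma> * (y - x)" and A: "x \<in> A" "A \<in> sets borel"
  shows "- rate x
    \<le> liminf (\<lambda>n. ereal (1 / real n) * elog (emeasure (conv_pow \<nu> n) ((\<lambda>x. real n * x) ` A)))"
proof (cases "measure \<nu> {x} = 0")
  case True
  have "rate x = \<infinity>"
    unfolding rate_eq
  proof (rule SUP_PInfty)
    fix n :: nat
    have "\<forall>\<^sub>F k in sequentially. mgf x (- (real k * \<sigma>)) < exp (- real n)"
      using mgf_tendsto_atom[OF assms(1) AE] True by (intro order_tendstoD) auto
    then obtain k where "mgf x (- (real k * \<sigma>)) < exp (- real n)"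
      by (auto simp: eventually_sequentially)
    then have "ln (mgf x (- (real k * \<sigma>))) < ln (exp (- real n))"
      by (subst ln_less_cancel_iff) (use mgf_pos in auto)
    then show "\<exists>t\<in>UNIV. ereal (real n) \<le> ereal (- ln (mgf x t))"
      by (intro bexI[of _ "- (real k * \<sigma>)"]) auto
  qed
  then show ?thesis by simp
next
  case False
  then have p: "0 < measure \<nu> {x}" by (simp add: less_le)
  have "(\<lambda>k. ln (mgf x (- (real k * \<sigma>)))) \<longlonglongrightarrow> ln (measure \<nu> {x})"
    by (intro tendsto_ln mgf_tendsto_atom assms False)
  then have lim: "(\<lambda>k. ereal (ln (mgf x (- (real k * \<sigma>))))) \<longlonglongrightarrow> ereal (ln (measure \<nu> {x}))"
    by simp
  have "- rate x \<le> ereal (ln (measure \<nu> {x}))"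
    by (rule LIMSEQ_le_const[OF lim]) (auto intro: neg_rate_le)
  also have "\<dots> \<le> liminf (\<lambda>n. ereal (1 / real n) * elog (emeasure (conv_pow \<nu> n) ((\<lambda>x. real n * x) ` A)))"
  proof (rule le_liminf_elog[of 1])
    show "\<forall>\<^sub>F n in sequentially. ennreal (1 * exp (real n * ln (measure \<nu> {x})))
      \<le> emeasure (conv_pow \<nu> n) ((\<lambda>x. real n * x) ` A)"
      using eventually_gt_at_top[of 0]
    proof eventually_elim
      fix n :: nat assume "0 < n"
      have "ennreal (1 * exp (real n * ln (measure \<nu> {x}))) = emeasure \<nu> {x} ^ n"
        using p by (simp add: exp_of_nat_mult emeasure_eq_measure ennreal_power)
      also have "\<dots> \<le> emeasure (conv_pow \<nu> n) {real n * x}"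
        by (rule emeasure_singleton_conv_pow)
      also have "\<dots> \<le> emeasure (conv_pow \<nu> n) ((\<lambda>x. real n * x) ` A)"
        using A \<open>0 < n\<close> by (intro emeasure_mono) (auto simp: sets_dilation)
      finally show "ennreal (1 * exp (real n * ln (measure \<nu> {x})))
        \<le> emeasure (conv_pow \<nu> n) ((\<lambda>x. real n * x) ` A)" .
    qed
  qed simp
  finally show ?thesis .
qed

lemma lower_bound:
  assumes "A \<in> sets borel"
  shows "- (INF x\<in>interior A. rate x)
    \<le> liminf (\<lambda>n. ereal (1 / real n) * elog (emeasure (conv_pow \<nu> n) ((\<lambda>x. real n * x) ` A)))"
    (is "_ \<le> ?L")
proof -
  have "- rate x \<le> ?L" if x: "x \<in> interior A" for x
  proof -
    have "x \<in> A" using x interior_subset by auto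
    show ?thesis
    proof (cases "emeasure \<nu> {x<..} = 0 \<or> emeasure \<nu> {..<x} = 0")
      case True
      then show ?thesis
      proof
        assume "emeasure \<nu> {x<..} = 0"
        then have "AE y in \<nu>. y \<notin> {x<..}" by (intro AE_not_in) (simp add: null_sets_def)
        then have "AE y in \<nu>. 0 \<le> - 1 * (y - x)" by eventually_elim simp
        then show ?thesis by (rule le_liminf_one_sided[OF _ _ \<open>x \<in> A\<close> assms, rotated]) simp
      next
        assume "emeasure \<nu> {..<x} = 0"
        then have "AE y in \<nu>. y \<notin> {..<x}" by (intro AE_not_in) (simp add: null_sets_def)
        then have "AE y in \<nu>. 0 \<le> 1 * (y - x)" by eventually_elim simp
        then show ?thesis by (rule le_liminf_one_sided[OF _ _ \<open>x \<in> A\<close> assms, rotated]) simp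
      qed
    next
      case False
      obtain d where d: "0 < d" "ball x d \<subseteq> A"
        using x by (auto simp: mem_interior)
      then have sub: "{x - d<..<x + d} \<subseteq> A"
        by (auto simp: ball_eq_greaterThanLessThan)
      show ?thesis
      proof (rule ereal_le_epsilon2)
        fix \<epsilon> :: real assume "0 < \<epsilon>"
        with le_liminf_two_sided[OF this d(1) sub assms] False
        obtain t where "ereal (ln (mgf x t) - \<epsilon>) \<le> ?L" by auto
        then have "ereal (ln (mgf x t)) \<le> ?L + ereal \<epsilon>"
          by (cases ?L) auto
        moreover have "- rate x \<le> ereal (ln (mgf x t))"
          by (rule neg_rate_le)
        ultimately show "- rate x \<le> ?L + ereal \<epsilon>" by simp
      qed
    qed
  qed
  then have "- ?L \<le> (INF x\<in>interior A. rate x)"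
    by (intro INF_greatest) (metis ereal_minus_le_minus ereal_uminus_uminus)
  then show ?thesis
    by (metis ereal_minus_le_minus ereal_uminus_uminus)
qed

theorem cramer:
  "large_deviation_bounds (\<lambda>n A. emeasure (conv_pow \<nu> n) ((\<lambda>x. real n * x) ` A)) rate"
  unfolding large_deviation_bounds_def
  using lower_bound upper_bound Liminf_le_Limsup[OF trivial_limit_sequentially] by blast

end

section \<open>The mean of the branching random walk\<close>

text \<open>Replacing one coordinate by an independent copy preserves a product law. This serves
  twice: for the offspring vector of one particle and for one coordinate of the environment.\<close>

lemma nn_integral_PiM_resample:
  fixes M :: "'i \<Rightarrow> 'a measure" and F :: "('i \<Rightarrow> 'a) \<Rightarrow> ennreal"
  assumes "\<And>j. prob_space (M j)" and F [measurable]: "F \<in> borel_measurable (PiM UNIV M)"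
  shows "(\<integral>\<^sup>+x. F x \<partial>PiM UNIV M) = (\<integral>\<^sup>+x. \<integral>\<^sup>+a. F (x(i := a)) \<partial>M i \<partial>PiM UNIV M)"
proof -
  interpret P: prob_space "PiM UNIV M" by (rule prob_space_PiM) (rule assms)
  interpret Mi: prob_space "M i" by (rule assms)
  interpret pair_sigma_finite "M i" "PiM UNIV M" ..
  have upd [measurable]: "(\<lambda>(a, x). x(i := a)) \<in> M i \<Otimes>\<^sub>M PiM UNIV M \<rightarrow>\<^sub>M PiM UNIV M"
    by (simp add: split_beta' measurable_fun_upd[where J=UNIV])
  have "(\<integral>\<^sup>+x. F x \<partial>PiM UNIV M)
      = (\<integral>\<^sup>+x. F x \<partial>distr (M i \<Otimes>\<^sub>M PiM UNIV M) (PiM UNIV M) (\<lambda>(a, x). x(i := a)))"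
    using distr_pair_PiM_eq_PiM[of UNIV M i] assms(1) by simp
  also have "\<dots> = (\<integral>\<^sup>+z. (case z of (a, x) \<Rightarrow> F (x(i := a))) \<partial>(M i \<Otimes>\<^sub>M PiM UNIV M))"
    by (subst nn_integral_distr) (auto intro!: nn_integral_cong)
  also have "\<dots> = (\<integral>\<^sup>+x. \<integral>\<^sup>+a. F (x(i := a)) \<partial>M i \<partial>PiM UNIV M)"
    by (subst nn_integral_snd[symmetric]) (simp_all add: measurable_compose[OF upd F, unfolded split_beta'] split_beta')
  finally show ?thesis .
qed

section \<open>Generations, positions and their measurability\<close>

lemma finite_generation: "finite (generation X n)"
proof (induction n)
  case (Suc n)
  have "generation X (Suc n) = (\<Union>u\<in>generation X n. (\<lambda>i. i # u) ` {..<fst (X u)})"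
    by auto
  then show ?case using Suc by simp
qed simp

lemma sum_generation_Suc:
  fixes g :: "particle \<Rightarrow> ennreal"
  shows "(\<Sum>v\<in>generation X (Suc n). g v) = (\<Sum>u\<in>generation X n. \<Sum>i<fst (X u). g (i # u))"
proof -
  have "generation X (Suc n) = (\<lambda>(u, i). i # u) ` (SIGMA u:generation X n. {..<fst (X u)})"
    by auto
  moreover have "inj_on (\<lambda>(u, i). i # u) (SIGMA u:generation X n. {..<fst (X u)})"
    by (auto simp: inj_on_def)
  ultimately have "(\<Sum>v\<in>generation X (Suc n). g v)
      = (\<Sum>(u, i)\<in>(SIGMA u:generation X n. {..<fst (X u)}). g (i # u))"
    by (simp add: sum.reindex split_def del: generation.simps)
  then show ?thesis
    by (simp add: sum.Sigma finite_generation del: generation.simps)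
qed

lemma length_generation: "u \<in> generation X n \<Longrightarrow> length u = n"
  by (induction n arbitrary: u) auto

text \<open>Membership in generation \<open>n\<close> is decided by the marks of the strict
  ancestors, so altering the mark of a particle of length \<open>n\<close> leaves that generation
  unchanged.\<close>

lemma generation_cong:
  "(\<And>v. length v < n \<Longrightarrow> X v = Y v) \<Longrightarrow> generation X n = generation Y n"
proof (induction n)
  case (Suc n)
  then have "generation X n = generation Y n" by auto
  moreover have "X u = Y u" if "u \<in> generation Y n" for u
    using Suc.prems[of u] length_generation[OF that] by simp
  ultimately show ?case by auto
qed simp

lemma position_cong:
  "(\<And>v. length v < length u \<Longrightarrow> X v = Y v) \<Longrightarrow> position X u = position Y u"
  by (induction u) auto

text \<open>The random index set becomes an indicator over the fixed countable set of all particles,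
  which makes measurability and the exchange of sum and integral available.\<close>

lemma sum_generation_eq:
  fixes g :: "particle \<Rightarrow> ennreal"
  shows "(\<Sum>u\<in>generation X n. g u) = (\<integral>\<^sup>+u. g u * indicator (generation X n) u \<partial>count_space UNIV)"
  using nn_integral_count_space_finite[OF finite_generation[of X n], of g]
  by (simp add: nn_integral_count_space_indicator)

lemma measurable_fst_offspring [measurable]: "fst \<in> offspring_space \<rightarrow>\<^sub>M count_space UNIV"
  unfolding offspring_space_def by measurable

lemma measurable_snd_offspring [measurable]:
  "(\<lambda>y. snd y i) \<in> borel_measurable offspring_space"
  unfolding offspring_space_def by measurable

lemma measurable_marks [measurable]: "(\<lambda>X. X u) \<in> marks_space \<rightarrow>\<^sub>M offspring_space"
  unfolding marks_space_def by measurable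

lemma measurable_position [measurable]: "(\<lambda>X. position X u) \<in> borel_measurable marks_space"
  by (induction u) simp_all

lemma sets_mem_generation [measurable]: "Measurable.pred marks_space (\<lambda>X. u \<in> generation X n)"
proof (induction n arbitrary: u)
  case (Suc n)
  show ?case
  proof (cases u)
    case (Cons i v)
    have [measurable]: "Measurable.pred marks_space (\<lambda>X. v \<in> generation X n)"
      by (rule Suc)
    have "Measurable.pred marks_space (\<lambda>X. v \<in> generation X n \<and> i < fst (X v))"
      by measurable
    then show ?thesis by (simp add: Cons)
  qed simp
qed simp

definition gen_sum :: "(real \<Rightarrow> ennreal) \<Rightarrow> marks \<Rightarrow> nat \<Rightarrow> ennreal" where
  "gen_sum f X n = (\<Sum>u\<in>generation X n. f (position X u))"

definition offspring_sum :: "(real \<Rightarrow> ennreal) \<Rightarrow> offspring \<Rightarrow> ennreal" where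
  "offspring_sum f y = (\<Sum>i<fst y. f (snd y i))"

lemma offspring_sum_eq:
  "offspring_sum f y = (\<integral>\<^sup>+i. f (snd y i) * (if i < fst y then 1 else 0) \<partial>count_space UNIV)"
proof -
  have "offspring_sum f y = (\<integral>\<^sup>+i. f (snd y i) \<partial>count_space {..<fst y})"
    by (simp add: offspring_sum_def nn_integral_count_space_finite)
  also have "\<dots> = (\<integral>\<^sup>+i. f (snd y i) * indicator {..<fst y} i \<partial>count_space UNIV)"
    by (rule nn_integral_count_space_indicator) simp
  finally show ?thesis
    by (simp add: indicator_def of_bool_def)
qed

lemma measurable_nn_integral_count_space:
  fixes f :: "'a \<Rightarrow> 'i::countable \<Rightarrow> ennreal"
  assumes "\<And>i. (\<lambda>x. f x i) \<in> borel_measurable M"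
  shows "(\<lambda>x. \<integral>\<^sup>+i. f x i \<partial>count_space UNIV) \<in> borel_measurable M"
proof -
  interpret sigma_finite_measure "count_space (UNIV :: 'i set)"
    by (rule sigma_finite_measure_count_space)
  have "case_prod f \<in> borel_measurable (M \<Otimes>\<^sub>M count_space UNIV)"
    unfolding split_beta' using assms
    by (intro measurable_compose_countable'[where g = snd and f = "\<lambda>i z. f (fst z) i" and I = UNIV]) auto
  then show ?thesis
    by (rule borel_measurable_nn_integral)
qed

lemma measurable_gen_sum [measurable]:
  assumes [measurable]: "f \<in> borel_measurable borel"
  shows "(\<lambda>X. gen_sum f X n) \<in> borel_measurable marks_space"
  unfolding gen_sum_def sum_generation_eq
  by (rule measurable_nn_integral_count_space) (simp add: indicator_def)

lemma measurable_offspring_sum: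
  assumes [measurable]: "(\<lambda>(a, r). f a r) \<in> borel_measurable (A \<Otimes>\<^sub>M borel)"
    and [measurable]: "h \<in> A \<rightarrow>\<^sub>M offspring_space"
  shows "(\<lambda>a. offspring_sum (f a) (h a)) \<in> borel_measurable A"
  unfolding offspring_sum_eq
  by (rule measurable_nn_integral_count_space) measurable

section \<open>Quenched and averaged recursions\<close>

locale branching_kernel = D: prob_space D for D :: "'th measure" +
  fixes \<eta> :: "'th \<Rightarrow> offspring measure"
  assumes kernel: "\<eta> \<in> D \<rightarrow>\<^sub>M prob_algebra offspring_space"
begin

lemma kernel_subprob [measurable]: "\<eta> \<in> D \<rightarrow>\<^sub>M subprob_algebra offspring_space"
  using kernel by (rule measurable_prob_algebraD)

lemma prob_space_kernel: "\<theta> \<in> space D \<Longrightarrow> prob_space (\<eta> \<theta>)"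
  using measurable_space[OF kernel] by (simp add: space_prob_algebra)

lemma sets_kernel: "\<theta> \<in> space D \<Longrightarrow> sets (\<eta> \<theta>) = sets offspring_space"
  using measurable_space[OF kernel] by (simp add: space_prob_algebra)

abbreviation env :: "(nat \<Rightarrow> 'th) measure" where
  "env \<equiv> PiM UNIV (\<lambda>_. D)"

lemma prob_space_env: "prob_space env"
  by (intro prob_space_PiM D.prob_space_axioms)

lemma space_envD: "x \<in> space env \<Longrightarrow> x n \<in> space D"
  by (auto simp: space_PiM)

lemma sets_quenched: "x \<in> space env \<Longrightarrow> sets (quenched_law \<eta> x) = sets marks_space"
  unfolding quenched_law_def marks_space_def
  by (intro sets_PiM_cong) (auto simp: sets_kernel space_envD)

lemma prob_space_quenched: "x \<in> space env \<Longrightarrow> prob_space (quenched_law \<eta> x)"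
  unfolding quenched_law_def by (intro prob_space_PiM prob_space_kernel space_envD)

text \<open>It suffices to test on cylinders, an intersection-stable generator, where the quenched
  mass is a finite product of measurable functions of the environment.\<close>

lemma measurable_quenched: "quenched_law \<eta> \<in> env \<rightarrow>\<^sub>M prob_algebra marks_space"
proof (rule measurable_prob_algebra_generated[OF _ Int_stable_prod_algebra prod_algebra_sets_into_space])
  show "sets marks_space = sigma_sets (\<Pi>\<^sub>E i\<in>UNIV. space offspring_space)
      (prod_algebra UNIV (\<lambda>_. offspring_space))"
    unfolding marks_space_def by (rule sets_PiM)
  fix A assume "A \<in> prod_algebra UNIV (\<lambda>_::particle. offspring_space)"
  then obtain J B where A: "A = prod_emb UNIV (\<lambda>_. offspring_space) J (\<Pi>\<^sub>E u\<in>J. B u)"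
    and J: "finite J" and B: "\<And>u. u \<in> J \<Longrightarrow> B u \<in> sets offspring_space"
    by (rule prod_algebraE) blast
  have "emeasure (quenched_law \<eta> x) A = (\<Prod>u\<in>J. emeasure (\<eta> (x (length u))) (B u))"
    if x: "x \<in> space env" for x
  proof -
    have "A = prod_emb UNIV (\<lambda>u. \<eta> (x (length u))) J (\<Pi>\<^sub>E u\<in>J. B u)"
      using sets_eq_imp_space_eq[OF sets_kernel[OF space_envD[OF x]]]
      by (simp add: A prod_emb_def)
    then show ?thesis
      unfolding quenched_law_def using J B x
      by (simp add: emeasure_PiM_emb prob_space_kernel space_envD sets_kernel)
  qed
  moreover have "(\<lambda>x. emeasure (\<eta> (x (length u))) (B u)) \<in> borel_measurable env" if "u \<in> J" for u
    using B[OF that] by measurable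
  then have "(\<lambda>x. \<Prod>u\<in>J. emeasure (\<eta> (x (length u))) (B u)) \<in> borel_measurable env"
    by measurable
  ultimately show "(\<lambda>x. emeasure (quenched_law \<eta> x) A) \<in> borel_measurable env"
    by (subst measurable_cong) auto
qed (simp_all add: prob_space_quenched sets_quenched)

lemma measurable_quenched_subprob [measurable]: "quenched_law \<eta> \<in> env \<rightarrow>\<^sub>M subprob_algebra marks_space"
  using measurable_quenched by (rule measurable_prob_algebraD)

text \<open>The expected sum of \<open>f\<close> over the children of a particle at \<open>s\<close>
  in environment \<theta>: the unnormalised transition operator of one generation.\<close>

definition step :: "(real \<Rightarrow> ennreal) \<Rightarrow> 'th \<Rightarrow> real \<Rightarrow> ennreal" where
  "step f \<theta> s = (\<integral>\<^sup>+y. offspring_sum (\<lambda>r. f (s + r)) y \<partial>\<eta> \<theta>)"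

lemma measurable_offspring_sum_shift [measurable]:
  assumes [measurable]: "f \<in> borel_measurable borel"
    and [measurable]: "a \<in> borel_measurable A" "h \<in> A \<rightarrow>\<^sub>M offspring_space"
  shows "(\<lambda>z. offspring_sum (\<lambda>r. f (a z + r)) (h z)) \<in> borel_measurable A"
  by (rule measurable_offspring_sum) measurable

lemma measurable_step [measurable]:
  assumes [measurable]: "f \<in> borel_measurable borel"
    and [measurable]: "h \<in> A \<rightarrow>\<^sub>M D" "a \<in> borel_measurable A"
  shows "(\<lambda>z. step f (h z) (a z)) \<in> borel_measurable A"
  unfolding step_def
  by (rule nn_integral_measurable_subprob_algebra2[where N = offspring_space]) measurable

definition quenched_sum :: "(real \<Rightarrow> ennreal) \<Rightarrow> nat \<Rightarrow> (nat \<Rightarrow> 'th) \<Rightarrow> ennreal" where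
  "quenched_sum f n x = (\<integral>\<^sup>+X. gen_sum f X n \<partial>quenched_law \<eta> x)"

lemma measurable_quenched_sum [measurable]:
  assumes [measurable]: "f \<in> borel_measurable borel"
  shows "quenched_sum f n \<in> borel_measurable env"
  unfolding quenched_sum_def[abs_def]
  by (rule nn_integral_measurable_subprob_algebra2[where N = marks_space]) measurable

lemma quenched_sum_0: "x \<in> space env \<Longrightarrow> quenched_sum f 0 x = f 0"
  using prob_space.emeasure_space_1[OF prob_space_quenched]
  by (simp add: quenched_sum_def gen_sum_def)

text \<open>The offspring vector of a particle of generation \<open>n\<close> is independent of its
  position and of its being alive, so it can be integrated first. Peeling off the last generation
  changes \<open>f\<close> but keeps the environment unshifted.\<close>

lemma quenched_sum_Suc:
  assumes [measurable]: "f \<in> borel_measurable borel" and x: "x \<in> space env"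
  shows "quenched_sum f (Suc n) x = quenched_sum (step f (x n)) n x"
proof -
  note [measurable_cong] = sets_quenched[OF x]
  have x_space: "x n \<in> space D" for n using x by (rule space_envD)
  let ?Q = "quenched_law \<eta> x"
  have split: "gen_sum f X (Suc n) = (\<integral>\<^sup>+u. offspring_sum (\<lambda>r. f (position X u + r)) (X u)
      * indicator (generation X n) u \<partial>count_space UNIV)" for X
    unfolding sum_generation_eq[symmetric] gen_sum_def sum_generation_Suc offspring_sum_def by simp
  have meas: "(\<lambda>X. offspring_sum (\<lambda>r. f (position X u + r)) (X u) * indicator (generation X n) u)
      \<in> borel_measurable marks_space" for u
    by (simp add: indicator_def)
  \<comment> \<open>For a name \<open>u\<close> of length other than \<open>n\<close> both sides
    vanish; otherwise the mark of \<open>u\<close> is resampled, which affects neither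
    \<open>position X u\<close> nor \<open>generation X n\<close>.\<close>
  have resample: "(\<integral>\<^sup>+X. offspring_sum (\<lambda>r. f (position X u + r)) (X u) * indicator (generation X n) u \<partial>?Q)
      = (\<integral>\<^sup>+X. step f (x n) (position X u) * indicator (generation X n) u \<partial>?Q)" for u
  proof (cases "length u = n")
    case True
    have gen: "generation (X(u := y)) n = generation X n" for X y
      by (rule generation_cong) (use True in auto)
    have pos: "position (X(u := y)) u = position X u" for X y
      by (rule position_cong) auto
    have "(\<integral>\<^sup>+X. offspring_sum (\<lambda>r. f (position X u + r)) (X u) * indicator (generation X n) u \<partial>?Q)
        = (\<integral>\<^sup>+X. \<integral>\<^sup>+y. offspring_sum (\<lambda>r. f (position X u + r)) y * indicator (generation X n) u
            \<partial>\<eta> (x n) \<partial>?Q)"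
      unfolding quenched_law_def
      by (subst nn_integral_PiM_resample[where i = u])
        (use meas measurable_cong_sets[OF sets_quenched[OF x] refl] in
          \<open>simp_all add: prob_space_kernel x_space gen pos True flip: quenched_law_def\<close>)
    also have "\<dots> = (\<integral>\<^sup>+X. step f (x n) (position X u) * indicator (generation X n) u \<partial>?Q)"
      unfolding step_def
      by (intro nn_integral_cong nn_integral_multc)
        (simp add: measurable_cong_sets[OF sets_kernel[OF x_space] refl])
    finally show ?thesis .
  next
    case False
    then have "u \<notin> generation X n" for X using length_generation by blast
    then show ?thesis by simp
  qed
  have meas': "(\<lambda>X. step f (x n) (position X u) * indicator (generation X n) u)
      \<in> borel_measurable marks_space" for u
    using x_space by (simp add: indicator_def)
  have "quenched_sum f (Suc n) x
      = (\<integral>\<^sup>+u. \<integral>\<^sup>+X. offspring_sum (\<lambda>r. f (position X u + r)) (X u) * indicator (generation X n) u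
          \<partial>?Q \<partial>count_space UNIV)"
    unfolding quenched_sum_def split
    by (rule nn_integral_count_space_nn_integral)
      (use meas measurable_cong_sets[OF sets_quenched[OF x] refl] in simp_all)
  also have "\<dots> = (\<integral>\<^sup>+X. \<integral>\<^sup>+u. step f (x n) (position X u) * indicator (generation X n) u
          \<partial>count_space UNIV \<partial>?Q)"
    unfolding resample
    by (rule nn_integral_count_space_nn_integral[symmetric])
      (use meas' measurable_cong_sets[OF sets_quenched[OF x] refl] in simp_all)
  also have "\<dots> = quenched_sum (step f (x n)) n x"
    unfolding quenched_sum_def gen_sum_def sum_generation_eq ..
  finally show ?thesis .
qed

lemma measurable_step_fixed:
  assumes [measurable]: "f \<in> borel_measurable borel" and "\<theta> \<in> space D"
  shows "step f \<theta> \<in> borel_measurable borel"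
  using measurable_step[OF assms(1), of "\<lambda>_. \<theta>" borel "\<lambda>s. s"] assms by simp

text \<open>Generation \<open>n\<close> sees only the environments with index below
  \<open>n\<close>. The induction needs arbitrary \<open>f\<close>, since each step of the recursion
  replaces it.\<close>

lemma quenched_sum_cong:
  assumes "f \<in> borel_measurable borel" "x \<in> space env" "x' \<in> space env" "\<And>j. j < n \<Longrightarrow> x j = x' j"
  shows "quenched_sum f n x = quenched_sum f n x'"
  using assms
proof (induction n arbitrary: f)
  case 0
  then show ?case by (simp add: quenched_sum_0)
next
  case (Suc n)
  have "quenched_sum (step f (x n)) n x = quenched_sum (step f (x n)) n x'"
    by (rule Suc.IH) (use Suc.prems in \<open>auto intro: measurable_step_fixed space_envD\<close>)
  with Suc.prems show ?case by (simp add: quenched_sum_Suc)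
qed

definition mean_step :: "(real \<Rightarrow> ennreal) \<Rightarrow> real \<Rightarrow> ennreal" where
  "mean_step f s = (\<integral>\<^sup>+\<theta>. step f \<theta> s \<partial>D)"

lemma measurable_mean_step [measurable]:
  assumes [measurable]: "f \<in> borel_measurable borel"
  shows "mean_step f \<in> borel_measurable borel"
  unfolding mean_step_def[abs_def] by measurable

text \<open>The product form of \<open>env\<close> enters here: the coordinate \<open>n\<close> can
  be resampled. After \<open>quenched_sum_Suc\<close> it occurs only in
  \<open>step f \<theta>\<close>, and by Fubini's theorem its average passes inside the sum.\<close>

lemma nn_integral_quenched_sum_Suc:
  assumes [measurable]: "f \<in> borel_measurable borel"
  shows "(\<integral>\<^sup>+x. quenched_sum f (Suc n) x \<partial>env) = (\<integral>\<^sup>+x. quenched_sum (mean_step f) n x \<partial>env)"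
proof -
  have upd: "x(n := \<theta>) \<in> space env" if "x \<in> space env" "\<theta> \<in> space D" for x \<theta>
    using that by (auto simp: space_PiM)
  have "(\<integral>\<^sup>+x. quenched_sum f (Suc n) x \<partial>env)
      = (\<integral>\<^sup>+x. \<integral>\<^sup>+\<theta>. quenched_sum f (Suc n) (x(n := \<theta>)) \<partial>D \<partial>env)"
    by (rule nn_integral_PiM_resample) (simp_all add: D.prob_space_axioms)
  also have "\<dots> = (\<integral>\<^sup>+x. quenched_sum (mean_step f) n x \<partial>env)"
  proof (rule nn_integral_cong)
    fix x assume x: "x \<in> space env"
    note [measurable_cong] = sets_quenched[OF x]
    let ?Q = "quenched_law \<eta> x"
    interpret Q: prob_space ?Q using x by (rule prob_space_quenched)
    interpret pair_sigma_finite D ?Q ..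
    have "(\<integral>\<^sup>+\<theta>. quenched_sum f (Suc n) (x(n := \<theta>)) \<partial>D) = (\<integral>\<^sup>+\<theta>. quenched_sum (step f \<theta>) n x \<partial>D)"
    proof (rule nn_integral_cong)
      fix \<theta> assume \<theta>: "\<theta> \<in> space D"
      have "quenched_sum f (Suc n) (x(n := \<theta>)) = quenched_sum (step f \<theta>) n (x(n := \<theta>))"
        using quenched_sum_Suc[OF assms upd[OF x \<theta>], of n] by simp
      also have "\<dots> = quenched_sum (step f \<theta>) n x"
        by (rule quenched_sum_cong[OF measurable_step_fixed[OF assms \<theta>] upd[OF x \<theta>] x]) simp
      finally show "quenched_sum f (Suc n) (x(n := \<theta>)) = quenched_sum (step f \<theta>) n x" .
    qed
    also have "\<dots> = (\<integral>\<^sup>+\<theta>. \<integral>\<^sup>+X. gen_sum (step f \<theta>) X n \<partial>?Q \<partial>D)"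
      by (simp add: quenched_sum_def)
    also have "\<dots> = (\<integral>\<^sup>+X. \<integral>\<^sup>+\<theta>. gen_sum (step f \<theta>) X n \<partial>D \<partial>?Q)"
    proof (rule Fubini'[symmetric])
      show "(\<lambda>(\<theta>, X). gen_sum (step f \<theta>) X n) \<in> borel_measurable (D \<Otimes>\<^sub>M ?Q)"
        unfolding gen_sum_def sum_generation_eq split_beta'
        by (rule measurable_nn_integral_count_space) (simp add: indicator_def)
    qed
    also have "\<dots> = quenched_sum (mean_step f) n x"
      unfolding quenched_sum_def gen_sum_def mean_step_def
      by (intro nn_integral_cong nn_integral_sum) simp
    finally show "(\<integral>\<^sup>+\<theta>. quenched_sum f (Suc n) (x(n := \<theta>)) \<partial>D) = quenched_sum (mean_step f) n x" .
  qed
  finally show ?thesis .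
qed

section \<open>Mean offspring measure and convolution identity\<close>

text \<open>The measure \<open>E Z\<^sub>1\<close>. An offspring vector averaged over the
  environment is paired with a child index under counting measure; the density keeps the indices of
  actual children, and the image records their displacement.\<close>

definition intensity :: "real measure" where
  "intensity = distr (density ((D \<bind> \<eta>) \<Otimes>\<^sub>M count_space UNIV) (\<lambda>(y, i). if i < fst y then 1 else 0))
     borel (\<lambda>(y, i). snd y i)"

lemma sets_intensity [measurable_cong, simp]: "sets intensity = sets borel"
  by (simp add: intensity_def)

lemma nn_integral_intensity:
  assumes [measurable]: "f \<in> borel_measurable borel"
  shows "(\<integral>\<^sup>+r. f (s + r) \<partial>intensity) = mean_step f s"
proof -
  have sets_E [measurable_cong]: "sets (D \<bind> \<eta>) = sets offspring_space"
    by (rule sets_bind[OF sets_kernel D.not_empty])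
  have fst_meas: "(\<lambda>z. fst (fst z)) \<in> (D \<bind> \<eta>) \<Otimes>\<^sub>M count_space (UNIV :: nat set) \<rightarrow>\<^sub>M count_space UNIV"
    by (rule measurable_compose[OF measurable_fst])
      (simp add: measurable_cong_sets[OF sets_E refl])
  have snd_meas: "(\<lambda>z. snd (fst z) i) \<in> borel_measurable ((D \<bind> \<eta>) \<Otimes>\<^sub>M count_space (UNIV :: nat set))" for i
    by (rule measurable_compose[OF measurable_fst])
      (simp add: measurable_cong_sets[OF sets_E refl])
  have [measurable]: "(\<lambda>(y, i). if i < fst y then 1 else 0 :: ennreal)
      \<in> borel_measurable ((D \<bind> \<eta>) \<Otimes>\<^sub>M count_space UNIV)"
    unfolding split_beta'
    by (rule measurable_compose_countable'[where g = snd
          and f = "\<lambda>i z. if i < fst (fst z) then 1 else 0" and I = UNIV])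
      (simp_all add: measurable_compose[OF fst_meas, of "\<lambda>m. if _ < m then 1 else 0 :: ennreal"])
  have [measurable]: "(\<lambda>(y, i). snd y i) \<in> borel_measurable ((D \<bind> \<eta>) \<Otimes>\<^sub>M count_space UNIV)"
    unfolding split_beta'
    by (rule measurable_compose_countable'[where g = snd and f = "\<lambda>i z. snd (fst z) i" and I = UNIV])
      (simp_all add: snd_meas)
  interpret sigma_finite_measure "count_space (UNIV :: nat set)"
    by (rule sigma_finite_measure_count_space)
  have "(\<integral>\<^sup>+r. f (s + r) \<partial>intensity)
      = (\<integral>\<^sup>+(y, i). (if i < fst y then 1 else 0) * f (s + snd y i) \<partial>((D \<bind> \<eta>) \<Otimes>\<^sub>M count_space UNIV))"
    unfolding intensity_def
    by (subst nn_integral_distr, simp, simp, subst nn_integral_density)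
      (auto simp: split_beta' intro!: nn_integral_cong)
  also have "\<dots> = (\<integral>\<^sup>+y. \<integral>\<^sup>+i. (if i < fst y then 1 else 0) * f (s + snd y i) \<partial>count_space UNIV \<partial>(D \<bind> \<eta>))"
    by (subst nn_integral_fst[symmetric]) (simp_all add: split_beta')
  also have "\<dots> = (\<integral>\<^sup>+y. offspring_sum (\<lambda>r. f (s + r)) y \<partial>(D \<bind> \<eta>))"
    by (simp add: offspring_sum_eq mult.commute)
  also have "\<dots> = mean_step f s"
    unfolding mean_step_def step_def
    by (rule nn_integral_bind[where B = offspring_space]) measurable
  finally show ?thesis .
qed

lemma nn_integral_quenched_sum_1:
  assumes "f \<in> borel_measurable borel"
  shows "(\<integral>\<^sup>+x. quenched_sum f (Suc 0) x \<partial>env) = (\<integral>\<^sup>+r. f r \<partial>intensity)"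
proof -
  have "(\<integral>\<^sup>+x. quenched_sum (mean_step f) 0 x \<partial>env) = (\<integral>\<^sup>+x. mean_step f 0 \<partial>env)"
    by (intro nn_integral_cong) (simp add: quenched_sum_0)
  then show ?thesis
    using nn_integral_quenched_sum_Suc[OF assms, of 0] nn_integral_intensity[OF assms, of 0]
      prob_space.emeasure_space_1[OF prob_space_env] by simp
qed

text \<open>By \<open>nn_integral_intensity\<close>, averaging over one generation integrates
  \<open>f (s + r)\<close> against the intensity, exactly as one convolution factor does. Both sides
  thus satisfy the same recursion in \<open>n\<close> and \<open>f\<close>.\<close>

lemma nn_integral_quenched_sum:
  assumes "finite_measure intensity" and "f \<in> borel_measurable borel"
  shows "(\<integral>\<^sup>+x. quenched_sum f n x \<partial>env) = (\<integral>\<^sup>+y. f y \<partial>conv_pow intensity n)"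
  using assms(2)
proof (induction n arbitrary: f)
  interpret \<nu>: finite_borel_measure intensity
    using assms(1) by (simp add: finite_borel_measure_def finite_borel_measure_axioms_def)
  case 0
  have "(\<integral>\<^sup>+x. quenched_sum f 0 x \<partial>env) = (\<integral>\<^sup>+x. f 0 \<partial>env)"
    by (intro nn_integral_cong) (simp add: quenched_sum_0)
  then show ?case
    using prob_space.emeasure_space_1[OF prob_space_env] \<nu>.nn_integral_conv_pow_0[OF 0] by simp
next
  interpret \<nu>: finite_borel_measure intensity
    using assms(1) by (simp add: finite_borel_measure_def finite_borel_measure_axioms_def)
  case (Suc n)
  then show ?case
    by (simp add: nn_integral_quenched_sum_Suc \<nu>.nn_integral_conv_pow_Suc nn_integral_intensity Suc.IH)
qed

lemma nn_integral_annealed: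
  assumes path: "path_law M \<Theta> \<xi> = env" and sets_\<Theta>: "sets \<Theta> = sets D"
    and F: "F \<in> borel_measurable (path_space \<Theta> \<Otimes>\<^sub>M marks_space)"
  shows "(\<integral>\<^sup>+z. F z \<partial>annealed_law M \<Theta> \<xi> \<eta>) = (\<integral>\<^sup>+x. \<integral>\<^sup>+X. F (x, X) \<partial>quenched_law \<eta> x \<partial>env)"
proof -
  let ?S = "path_space \<Theta> \<Otimes>\<^sub>M marks_space"
  have sets_path [measurable_cong]: "sets (path_space \<Theta>) = sets env"
    unfolding path_space_def by (rule sets_PiM_cong) (auto simp: sets_\<Theta>)
  have [measurable]: "(\<lambda>(x, X). return ?S (x, X)) \<in> env \<Otimes>\<^sub>M marks_space \<rightarrow>\<^sub>M subprob_algebra ?S"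
    by measurable
  have outer: "(\<lambda>x. quenched_law \<eta> x \<bind> (\<lambda>X. return ?S (x, X))) \<in> env \<rightarrow>\<^sub>M subprob_algebra ?S"
    by (rule measurable_bind'[where N = marks_space]) measurable
  have "(\<integral>\<^sup>+z. F z \<partial>annealed_law M \<Theta> \<xi> \<eta>)
      = (\<integral>\<^sup>+x. \<integral>\<^sup>+z. F z \<partial>(quenched_law \<eta> x \<bind> (\<lambda>X. return ?S (x, X))) \<partial>env)"
    unfolding annealed_law_def path by (rule nn_integral_bind[OF F outer])
  also have "\<dots> = (\<integral>\<^sup>+x. \<integral>\<^sup>+X. F (x, X) \<partial>quenched_law \<eta> x \<partial>env)"
  proof (rule nn_integral_cong)
    fix x assume x: "x \<in> space env"
    have x': "x \<in> space (path_space \<Theta>)"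
      using x sets_eq_imp_space_eq[OF sets_path] by simp
    have inner: "(\<lambda>X. return ?S (x, X)) \<in> quenched_law \<eta> x \<rightarrow>\<^sub>M subprob_algebra ?S"
      unfolding measurable_cong_sets[OF sets_quenched[OF x] refl] using x' by measurable
    have "(\<integral>\<^sup>+z. F z \<partial>(quenched_law \<eta> x \<bind> (\<lambda>X. return ?S (x, X))))
        = (\<integral>\<^sup>+X. \<integral>\<^sup>+z. F z \<partial>return ?S (x, X) \<partial>quenched_law \<eta> x)"
      by (rule nn_integral_bind[OF F inner])
    also have "\<dots> = (\<integral>\<^sup>+X. F (x, X) \<partial>quenched_law \<eta> x)"
      using x' sets_eq_imp_space_eq[OF sets_quenched[OF x]]
      by (intro nn_integral_cong nn_integral_return F) (simp add: space_pair_measure)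
    finally show "(\<integral>\<^sup>+z. F z \<partial>(quenched_law \<eta> x \<bind> (\<lambda>X. return ?S (x, X))))
        = (\<integral>\<^sup>+X. F (x, X) \<partial>quenched_law \<eta> x)" .
  qed
  finally show ?thesis .
qed

lemma m0_exp_eq: "m0_exp \<eta> x t = quenched_sum (\<lambda>r. ennreal (exp (t * r))) (Suc 0) x"
  by (simp add: m0_exp_def quenched_sum_def gen_sum_def sum_generation_Suc del: generation.simps(2))

lemma mean_m0_exp_eq:
  assumes "path_law M \<Theta> \<xi> = env" and "sets \<Theta> = sets D"
  shows "mean_m0_exp \<eta> (annealed_law M \<Theta> \<xi> \<eta>) t = (\<integral>\<^sup>+y. ennreal (exp (t * y)) \<partial>intensity)"
proof -
  have [measurable_cong]: "sets (path_space \<Theta>) = sets env"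
    unfolding path_space_def by (rule sets_PiM_cong) (auto simp: assms(2))
  have "mean_m0_exp \<eta> (annealed_law M \<Theta> \<xi> \<eta>) t
      = (\<integral>\<^sup>+x. \<integral>\<^sup>+X. m0_exp \<eta> x t \<partial>quenched_law \<eta> x \<partial>env)"
    unfolding mean_m0_exp_def by (subst nn_integral_annealed[OF assms]) (simp_all add: m0_exp_eq)
  also have "\<dots> = (\<integral>\<^sup>+x. quenched_sum (\<lambda>r. ennreal (exp (t * r))) (Suc 0) x \<partial>env)"
    by (intro nn_integral_cong)
      (simp add: m0_exp_eq prob_space.emeasure_space_1[OF prob_space_quenched])
  also have "\<dots> = (\<integral>\<^sup>+y. ennreal (exp (t * y)) \<partial>intensity)"
    by (rule nn_integral_quenched_sum_1) measurable
  finally show ?thesis .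
qed

lemma mean_Z_eq:
  assumes "path_law M \<Theta> \<xi> = env" and "sets \<Theta> = sets D"
    and "finite_measure intensity" and B [measurable]: "B \<in> sets borel"
  shows "mean_Z (annealed_law M \<Theta> \<xi> \<eta>) n B = emeasure (conv_pow intensity n) B"
proof -
  interpret \<nu>: finite_borel_measure intensity
    using assms(3) by (simp add: finite_borel_measure_def finite_borel_measure_axioms_def)
  have Z: "Z X n B = gen_sum (indicator B) X n" for X
    by (simp add: Z_def gen_sum_def)
  have "mean_Z (annealed_law M \<Theta> \<xi> \<eta>) n B = (\<integral>\<^sup>+x. quenched_sum (indicator B) n x \<partial>env)"
    unfolding mean_Z_def Z quenched_sum_def
    by (subst nn_integral_annealed[OF assms(1,2)]) simp_all
  also have "\<dots> = emeasure (conv_pow intensity n) B"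
    by (subst nn_integral_quenched_sum[OF assms(3)]) simp_all
  finally show ?thesis .
qed

end

lemma path_law_iid:
  assumes "random_environment M \<Theta> \<xi> \<eta>" and "iid M \<Theta> \<xi>"
  shows "path_law M \<Theta> \<xi> = PiM UNIV (\<lambda>_. distr M \<Theta> (\<xi> 0))"
proof -
  interpret prob_space M using assms(1) by (simp add: random_environment_def)
  have rv: "\<xi> n \<in> M \<rightarrow>\<^sub>M \<Theta>" for n using assms(1) by (simp add: random_environment_def)
  have "path_law M \<Theta> \<xi> = PiM UNIV (\<lambda>n. distr M \<Theta> (\<xi> n))"
    using assms(2) indep_vars_iff_distr_eq_PiM[of UNIV \<xi> "\<lambda>_. \<Theta>"] rv
    by (simp add: iid_def path_law_def path_space_def restrict_def)
  also have "(\<lambda>n. distr M \<Theta> (\<xi> n)) = (\<lambda>_. distr M \<Theta> (\<xi> 0))"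
    using assms(2) unfolding iid_def by blast
  finally show ?thesis .
qed

text \<open>The measure property is claimed from \<open>n = 1\<close> on: for \<open>n = 0\<close>
  every nonempty set is dilated to \<open>{0}\<close> and receives the value 1, which is not
  additive.\<close>

theorem theorem2p2:
  fixes M :: "'w measure" and \<Theta> :: "'th measure" and \<xi> :: "nat \<Rightarrow> 'w \<Rightarrow> 'th"
    and \<eta> :: "'th \<Rightarrow> offspring measure" and P :: "((nat \<Rightarrow> 'th) \<times> marks) measure"
    and \<mu> :: "nat \<Rightarrow> real set \<Rightarrow> ennreal"
  assumes "random_environment M \<Theta> \<xi> \<eta>"
    and P: "P = annealed_law M \<Theta> \<xi> \<eta>"
    and "standing_assumption \<eta> P"
    and "iid M \<Theta> \<xi>"
    and "\<forall>t. 0 < mean_m0_exp \<eta> P t \<and> mean_m0_exp \<eta> P t < \<infinity>"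
    and \<mu>: "\<And>n A. \<mu> n A = mean_Z P n ((\<lambda>x. real n * x) ` A)"
  shows "(\<forall>n\<ge>1. measure_space UNIV (sets borel) (\<mu> n) \<and> \<mu> n UNIV < \<infinity>) \<and>
    large_deviation_bounds \<mu> (legendre (Lambda_a \<eta> P))"
proof -
  let ?D = "distr M \<Theta> (\<xi> 0)"
  have env: "prob_space M" "\<xi> 0 \<in> M \<rightarrow>\<^sub>M \<Theta>" "\<eta> \<in> \<Theta> \<rightarrow>\<^sub>M prob_algebra offspring_space"
    using assms(1) by (simp_all add: random_environment_def)
  interpret branching_kernel ?D \<eta>
    using env by (intro branching_kernel.intro branching_kernel_axioms.intro prob_space.prob_space_distr) simp_all
  have path: "path_law M \<Theta> \<xi> = PiM UNIV (\<lambda>_. ?D)"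
    using assms(1,4) by (rule path_law_iid)
  have mean_exp: "mean_m0_exp \<eta> P t = (\<integral>\<^sup>+y. ennreal (exp (t * y)) \<partial>intensity)" for t
    unfolding P by (rule mean_m0_exp_eq[OF path]) simp
  \<comment> \<open>Taking \<open>t = 0\<close> in the moment hypothesis gives a total mass that is
    finite and nonzero.\<close>
  have total: "emeasure intensity UNIV = mean_m0_exp \<eta> P 0"
    using sets_eq_imp_space_eq[OF sets_intensity] by (simp add: mean_exp)
  have fin: "finite_measure intensity"
    using assms(5) sets_eq_imp_space_eq[OF sets_intensity]
    by (intro finite_measureI) (simp add: total less_top)
  interpret \<nu>: exponential_moments intensity
  proof (intro exponential_moments.intro finite_borel_measure.intro fin
      finite_borel_measure_axioms.intro exponential_moments_axioms.intro)
    show "emeasure intensity UNIV \<noteq> 0" unfolding total using assms(5) by (metis less_irrefl)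
    show "(\<integral>\<^sup>+y. ennreal (exp (t * y)) \<partial>intensity) < \<infinity>" for t
      using assms(5) by (simp flip: mean_exp)
  qed simp
  have \<mu>_eq: "\<mu> n A = emeasure (conv_pow intensity n) ((\<lambda>x. real n * x) ` A)"
    if "A \<in> sets borel" for n A
  proof -
    have "(\<lambda>x. real n * x) ` A \<in> sets borel"
      using that by (cases "n = 0") (auto simp: sets_dilation image_constant_conv)
    then show ?thesis
      unfolding \<mu> P by (intro mean_Z_eq[OF path _ fin]) simp_all
  qed
  have "legendre (Lambda_a \<eta> P) = \<nu>.rate"
    unfolding \<nu>.rate_def Lambda_a_def mean_exp ..
  then have ldp: "large_deviation_bounds \<mu> (legendre (Lambda_a \<eta> P))"
    using \<nu>.cramer by (simp add: large_deviation_bounds_def \<mu>_eq)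
  have "measure_space UNIV (sets borel) (\<mu> n) \<and> \<mu> n UNIV < \<infinity>" if "1 \<le> n" for n
  proof -
    interpret \<rho>: finite_measure "conv_pow intensity n" by (rule \<nu>.finite_measure_conv_pow)
    \<comment> \<open>On Borel sets \<open>\<mu> n\<close> agrees with this image measure and
      inherits countable additivity from it.\<close>
    define \<kappa> where "\<kappa> = distr (conv_pow intensity n) borel (\<lambda>y. y / real n)"
    have \<kappa>: "\<mu> n A = emeasure \<kappa> A" if "A \<in> sets borel" for A
      using that \<open>1 \<le> n\<close> by (simp add: \<mu>_eq \<kappa>_def emeasure_distr dilation_eq_vimage)
    have "\<mu> n UNIV < \<infinity>"
      using \<rho>.emeasure_finite by (simp add: \<mu>_eq less_top[symmetric])
    moreover have "measure_space UNIV (sets borel) (\<mu> n)"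
      unfolding measure_space_def
    proof (intro conjI)
      show "sigma_algebra UNIV (sets (borel :: real measure))"
        using sets.sigma_algebra_axioms[of "borel :: real measure"] by simp
      show "positive (sets borel) (\<mu> n)"
        by (simp add: positive_def \<kappa>)
      show "countably_additive (sets borel) (\<mu> n)"
        unfolding countably_additive_def
        by (auto simp: \<kappa> sets.countable_UN intro!: suminf_emeasure simp: \<kappa>_def)
    qed
    ultimately show ?thesis by simp
  qed
  with ldp show ?thesis by blast
qed

end
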